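(* Let $\omega\in\mathbb{R}$, $\lambda\in\mathbb{R}\setminus\{0\}$. The element $$\mathrm{C}_{\omega,\lambda}=\omega P_1^2e^{\lambda P_2}+\frac{4}{\lambda^2}\sinh^2\Bigl(\frac{\lambda}{2}P_2\Bigr)=\omega P_1^2e^{\lambda P_2}+2\,\frac{\cosh(\lambda P_2)-1}{\lambda^2}$$ is central in $U_\lambda(\mathfrak{iso}_\omega(2))$, and its action on the co-space $(\mathcal{A}_{\omega,\lambda},\triangleright,U_\lambda(\mathfrak{iso}_\omega(2)))$ is given, for every $f(a_1,a_2)\in\mathcal{A}_{\omega,\lambda}$, by $$\mathrm{C}_{\omega,\lambda}\triangleright f(a_1,a_2)=\Bigl[\omega\,\partial_{a_1}^2e^{\lambda\partial_{a_2}}+\frac{4}{\lambda^2}\sinh^2\Bigl(\frac\lambda2\partial_{a_2}\Bigr)\Bigr]f(a_1,a_2),$$ that is, $$\mathrm{C}_{\omega,\lambda}\triangleright f(a_1,a_2)=\omega\,\partial_{a_1}^2f(a_1,a_2+\lambda)+\frac{1}{\lambda^2}\bigl[f(a_1,a_2+\lambda)+f(a_1,a_2-\lambda)-2f(a_1,a_2)\bigr].$$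
   Context: The algebra $H=U_\lambda(\mathfrak{iso}_\omega(2))$ is the unital associative complex algebra generated by $J$ and the commutative subalgebra $\mathcal{L}=\mathbb{C}[P_1,P_2,e^{\pm\lambda P_2}]$ of functions on $\mathbb{R}^2$ (with $P_i(\alpha_1,\alpha_2)=\alpha_i$), subject to $[l,J]=\hat J(l)$ for $l\in\mathcal{L}$, where $\hat J$ is the derivation $$\hat J=-\Bigl[\frac{1-e^{-2\lambda P_2}}{2\lambda}+\frac12\lambda\omega P_1^2\Bigr]\frac{\partial}{\partial P_1}+\omega P_1\frac{\partial}{\partial P_2}.$$ Equivalently $[J,P_1]=\frac{1-e^{-2\lambda P_2}}{2\lambda}+\frac12\lambda\omega P_1^2$, $[J,P_2]=-\omega P_1$, $[P_1,P_2]=0$. As a vector space $H=\bigoplus_{m\ge0}J^m\mathcal{L}$. The dual Hopf algebra $F_\lambda(ISO_\omega(2))$ is generated by $\varphi,a_1,a_2$, with elements written in the normal ordering $\varphi^qa_1^ra_2^s$ and pairing determined by $\langle J^mP_1^nP_2^p,\varphi^qa_1^ra_2^s\rangle=m!\,n!\,p!\,\delta_m^q\delta_n^r\delta_p^s$; for general $l\in\mathcal{L}$ it is $\langle J^ml,\varphi^qa_1^ra_2^s\rangle=m!\,\delta_m^q\,(\partial_1^r\partial_2^sl)(0,0)$. $\mathcal{A}_{\omega,\lambda}$ is the subalgebra generated by $a_1,a_2$, which satisfy $[a_1,a_2]=\lambda a_1$; its elements $f(a_1,a_2)$ are the linear combinations of ordered monomials $a_1^ra_2^s$. It is stable under the left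 regular action of $H$ on $F_\lambda(ISO_\omega(2))$, defined by $\langle h',h\succ f\rangle=\langle h'h,f\rangle$ for $h,h'\in H$, and $\triangleright$ denotes the restriction of that action to $\mathcal{A}_{\omega,\lambda}$. $\partial_{a_1},\partial_{a_2}$ are formal partial derivatives on ordered monomials ($\partial_{a_1}a_1^ra_2^s=ra_1^{r-1}a_2^s$, $\partial_{a_2}a_1^ra_2^s=sa_1^ra_2^{s-1}$), functions of them are power series, and $f(a_1,a_2\pm\lambda)$ means replacing each $a_1^ra_2^s$ by $a_1^r(a_2\pm\lambda)^s$. *)

theory Defs
  imports
    "HOL-Analysis.Analysis"
    "HOL-Algebra.Ring"
    "HOL-Library.Function_Algebras"
    "HOL-Computational_Algebra.Polynomial"
    "HOL-Computational_Algebra.Formal_Power_Series"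
begin

section \<open>Ore extensions\<close>

text \<open>
  Both noncommutative algebras below are Ore extensions of a commutative ring \<open>S\<close> by one
  generator \<open>X\<close>, subject to \<open>l X = X \<sigma>(l) + \<delta>(l)\<close> for \<open>l \<in> S\<close>, with elements written in the
  normal ordering \<open>\<Sum>m. X^m l\<^sub>m\<close>.  The type of polynomials is used only as a container for the
  coefficients \<open>l\<^sub>m\<close>; its own (commutative) product is not the product of the algebra.
  The relation forces \<open>(\<Sum>m. X^m l\<^sub>m) X = \<Sum>m. X^(m+1) \<sigma>(l\<^sub>m) + X^m \<delta>(l\<^sub>m)\<close>, and hence
  \<open>h (\<Sum>n. X^n k\<^sub>n) = \<Sum>n. (h X^n) k\<^sub>n\<close>.
\<close>

definition ore_rmul :: "('a \<Rightarrow> 'a) \<Rightarrow> ('a \<Rightarrow> 'a) \<Rightarrow> 'a::comm_ring_1 poly \<Rightarrow> 'a poly" where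
  "ore_rmul \<sigma> \<delta> h = pCons 0 (map_poly \<sigma> h) + map_poly \<delta> h"

definition ore_mult ::
  "('a \<Rightarrow> 'a) \<Rightarrow> ('a \<Rightarrow> 'a) \<Rightarrow> 'a::comm_ring_1 poly \<Rightarrow> 'a poly \<Rightarrow> 'a poly" where
  "ore_mult \<sigma> \<delta> h k = (\<Sum>n\<le>degree k. smult (coeff k n) ((ore_rmul \<sigma> \<delta> ^^ n) h))"

definition ore_ring :: "'a::comm_ring_1 set \<Rightarrow> ('a \<Rightarrow> 'a) \<Rightarrow> ('a \<Rightarrow> 'a) \<Rightarrow> 'a poly ring" where
  "ore_ring S \<sigma> \<delta> = \<lparr>carrier = {h. \<forall>m. coeff h m \<in> S},
     mult = ore_mult \<sigma> \<delta>, one = 1, zero = 0, add = (+)\<rparr>"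

definition fun_ring :: "'a::comm_ring_1 set \<Rightarrow> 'a ring" where
  "fun_ring S = \<lparr>carrier = S, mult = (*), one = 1, zero = 0, add = (+)\<rparr>"

locale ore_data =
  fixes S :: "'a::comm_ring_1 set" and \<sigma> \<delta> :: "'a \<Rightarrow> 'a"
  assumes S_0 [simp]: "0 \<in> S" and S_1 [simp]: "1 \<in> S"
    and S_add [simp]: "\<And>a b. a \<in> S \<Longrightarrow> b \<in> S \<Longrightarrow> a + b \<in> S"
    and S_mult [simp]: "\<And>a b. a \<in> S \<Longrightarrow> b \<in> S \<Longrightarrow> a * b \<in> S"
    and S_uminus [simp]: "\<And>a. a \<in> S \<Longrightarrow> - a \<in> S"
    and \<sigma>_S [simp]: "\<And>a. a \<in> S \<Longrightarrow> \<sigma> a \<in> S" and \<delta>_S [simp]: "\<And>a. a \<in> S \<Longrightarrow> \<delta> a \<in> S"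
    and \<sigma>_1 [simp]: "\<sigma> 1 = 1"
    and \<sigma>_add: "\<And>a b. a \<in> S \<Longrightarrow> b \<in> S \<Longrightarrow> \<sigma> (a + b) = \<sigma> a + \<sigma> b"
    and \<sigma>_mult: "\<And>a b. a \<in> S \<Longrightarrow> b \<in> S \<Longrightarrow> \<sigma> (a * b) = \<sigma> a * \<sigma> b"
    and \<delta>_add: "\<And>a b. a \<in> S \<Longrightarrow> b \<in> S \<Longrightarrow> \<delta> (a + b) = \<delta> a + \<delta> b"
    and \<delta>_mult: "\<And>a b. a \<in> S \<Longrightarrow> b \<in> S \<Longrightarrow> \<delta> (a * b) = \<sigma> a * \<delta> b + \<delta> a * b"
begin

abbreviation "C \<equiv> {h. \<forall>m. coeff h m \<in> S}"
abbreviation "R \<equiv> ore_rmul \<sigma> \<delta>"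
abbreviation mul (infixl "\<odot>" 70) where "h \<odot> k \<equiv> ore_mult \<sigma> \<delta> h k"

lemma \<sigma>_0 [simp]: "\<sigma> 0 = 0" using \<sigma>_add[of 0 0] by simp
lemma \<delta>_0 [simp]: "\<delta> 0 = 0" using \<delta>_add[of 0 0] by simp
lemma \<delta>_1 [simp]: "\<delta> 1 = 0" using \<delta>_mult[of 1 1] by simp

lemma pCons_C [simp]: "pCons a p \<in> C \<longleftrightarrow> a \<in> S \<and> p \<in> C"
  by (auto simp: coeff_pCons split: nat.splits)

lemma map_C [simp]: "h \<in> C \<Longrightarrow> map_poly \<sigma> h \<in> C" "h \<in> C \<Longrightarrow> map_poly \<delta> h \<in> C"
  by (auto simp: coeff_map_poly)

lemma add_C [simp]: "h \<in> C \<Longrightarrow> k \<in> C \<Longrightarrow> h + k \<in> C" by auto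
lemma smult_C [simp]: "a \<in> S \<Longrightarrow> k \<in> C \<Longrightarrow> smult a k \<in> C" by auto

lemma R_C [simp]: "h \<in> C \<Longrightarrow> R h \<in> C"
  unfolding ore_rmul_def by (intro add_C) (simp_all del: mem_Collect_eq)

lemma C_0 [simp]: "0 \<in> C" by simp

lemma Rn_C [simp]: "h \<in> C \<Longrightarrow> (R ^^ n) h \<in> C"
  by (induction n) (simp_all del: mem_Collect_eq)

lemma map_poly_pCons_\<sigma>: "map_poly \<sigma> (pCons a p) = pCons (\<sigma> a) (map_poly \<sigma> p)"
  and map_poly_pCons_\<delta>: "map_poly \<delta> (pCons a p) = pCons (\<delta> a) (map_poly \<delta> p)"
  by (simp_all add: map_poly_pCons)

lemma R_add: "h \<in> C \<Longrightarrow> k \<in> C \<Longrightarrow> R (h + k) = R h + R k"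
  unfolding ore_rmul_def
  by (intro poly_eqI)
     (auto simp: coeff_pCons coeff_map_poly \<sigma>_add \<delta>_add split: nat.splits)

lemma R_smult:
  assumes "a \<in> S" "h \<in> C"
  shows "R (smult a h) = smult (\<sigma> a) (R h) + smult (\<delta> a) h"
  using assms unfolding ore_rmul_def
  by (intro poly_eqI)
     (auto simp: coeff_pCons coeff_map_poly \<sigma>_mult \<delta>_mult algebra_simps split: nat.splits)

lemma R_0 [simp]: "R 0 = 0" by (simp add: ore_rmul_def)

lemma ore_mult_bound:
  assumes "degree k \<le> N"
  shows "h \<odot> k = (\<Sum>n\<le>N. smult (coeff k n) ((R ^^ n) h))"
  unfolding ore_mult_def
  by (rule sum.mono_neutral_left) (use assms in \<open>auto simp: coeff_eq_0\<close>)

lemma mult_0_right [simp]: "h \<odot> 0 = 0" by (simp add: ore_mult_def)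

lemma mult_pCons: "h \<odot> pCons a k = smult a h + R h \<odot> k"
proof -
  have "h \<odot> pCons a k = (\<Sum>n\<le>Suc (degree k). smult (coeff (pCons a k) n) ((R ^^ n) h))"
    by (rule ore_mult_bound) (simp add: degree_pCons_le)
  also have "\<dots> = smult a h + R h \<odot> k"
    unfolding ore_mult_def by (simp add: sum.atMost_Suc_shift funpow_swap1 del: sum.atMost_Suc)
  finally show ?thesis .
qed

lemma mult_const: "h \<odot> [:a:] = smult a h" by (simp add: mult_pCons)

lemma mult_C [simp]: "h \<in> C \<Longrightarrow> k \<in> C \<Longrightarrow> h \<odot> k \<in> C"
proof (induction k arbitrary: h)
  case (pCons a k)
  then show ?case unfolding mult_pCons
    by (intro add_C smult_C) (simp_all del: mem_Collect_eq)
qed simp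

lemma mult_add_right: "h \<odot> (k + k') = h \<odot> k + h \<odot> k'"
proof -
  let ?N = "max (degree k) (degree k')"
  have "degree (k + k') \<le> ?N" by (rule degree_add_le_max)
  then show ?thesis
    by (simp add: ore_mult_bound[of _ ?N] smult_add_left sum.distrib)
qed

lemma mult_add_left: "h \<in> C \<Longrightarrow> h' \<in> C \<Longrightarrow> (h + h') \<odot> k = h \<odot> k + h' \<odot> k"
proof (induction k arbitrary: h h')
  case (pCons a k)
  from pCons.IH[OF R_C[OF pCons.prems(1)] R_C[OF pCons.prems(2)]] show ?case
    by (simp add: mult_pCons R_add[OF pCons.prems] smult_add_right)
qed simp

lemma mult_smult_right: "h \<odot> smult a k = smult a (h \<odot> k)"
  by (induction k arbitrary: h) (simp_all add: mult_pCons smult_add_right)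

lemma mult_R: "h \<in> C \<Longrightarrow> k \<in> C \<Longrightarrow> R (h \<odot> k) = h \<odot> R k"
proof (induction k arbitrary: h)
  case (pCons a k)
  have k: "k \<in> C" and a: "a \<in> S" using pCons.prems(2) by (simp_all del: mem_Collect_eq)
  have Rh: "R h \<in> C" by (rule R_C[OF pCons.prems(1)])
  have "R (h \<odot> pCons a k) = R (smult a h) + R (R h \<odot> k)"
    unfolding mult_pCons by (rule R_add[OF smult_C[OF a pCons.prems(1)] mult_C[OF Rh k]])
  also have "\<dots> = smult (\<sigma> a) (R h) + smult (\<delta> a) h + R h \<odot> R k"
    by (simp only: R_smult[OF a pCons.prems(1)] pCons.IH[OF Rh k])
  also have "\<dots> = h \<odot> R (pCons a k)"
    by (simp add: ore_rmul_def[of _ _ k] ore_rmul_def[of _ _ "pCons a k"] mult_add_right mult_pCons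
        map_poly_pCons_\<sigma> map_poly_pCons_\<delta>)
  finally show ?case .
qed simp

lemma mult_assoc: "h \<in> C \<Longrightarrow> k \<in> C \<Longrightarrow> p \<in> C \<Longrightarrow> (h \<odot> k) \<odot> p = h \<odot> (k \<odot> p)"
proof (induction p arbitrary: k)
  case (pCons a p)
  have p: "p \<in> C" using pCons.prems(3) by (simp del: mem_Collect_eq)
  show ?case
    by (simp only: mult_pCons mult_add_right mult_smult_right mult_R[OF pCons.prems(1,2)]
        pCons.IH[OF pCons.prems(1) R_C[OF pCons.prems(2)] p])
qed simp

lemma R_1: "R 1 = [:0, 1:]"
  by (simp add: ore_rmul_def one_pCons map_poly_pCons)

lemma R_pow: "(R ^^ n) 1 = monom 1 n"
proof (induction n)
  case (Suc n)
  have "R (monom 1 n) = monom 1 (Suc n)"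
    by (rule poly_eqI) (auto simp: ore_rmul_def coeff_pCons coeff_map_poly split: nat.splits)
  then show ?case using Suc by simp
qed simp

lemma mult_1_left [simp]: "1 \<odot> k = k"
  unfolding ore_mult_def R_pow
  by (simp add: smult_monom poly_as_sum_of_monoms)

lemma mult_1_right [simp]: "h \<odot> 1 = h"
  by (simp add: one_pCons mult_const)

lemma one_C: "1 \<in> C" by (simp add: one_pCons del: mem_Collect_eq)

theorem ring_ore: "ring (ore_ring S \<sigma> \<delta>)"
proof (rule ringI)
  show "abelian_group (ore_ring S \<sigma> \<delta>)"
  proof (rule abelian_groupI)
    fix x assume "x \<in> carrier (ore_ring S \<sigma> \<delta>)"
    then show "\<exists>y\<in>carrier (ore_ring S \<sigma> \<delta>). y \<oplus>\<^bsub>ore_ring S \<sigma> \<delta>\<^esub> x = \<zero>\<^bsub>ore_ring S \<sigma> \<delta>\<^esub>"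
      by (intro bexI[of _ "- x"]) (auto simp: ore_ring_def)
  qed (auto simp: ore_ring_def algebra_simps)
  show "Group.monoid (ore_ring S \<sigma> \<delta>)"
    by (rule monoidI)
       (use mult_C one_C mult_assoc in \<open>auto simp add: ore_ring_def\<close>)
qed (use mult_add_left mult_add_right in \<open>auto simp: ore_ring_def\<close>)

text \<open>The defining relation, and the decomposition into \<open>X^m l\<close>.\<close>

lemma ore_relation: "a \<in> S \<Longrightarrow> [:a:] \<odot> [:0, 1:] = [:0, 1:] \<odot> [:\<sigma> a:] + [:\<delta> a:]"
  by (simp add: mult_pCons mult_const ore_rmul_def map_poly_pCons)

lemma ore_monom: "([:0, 1:] [^]\<^bsub>ore_ring S \<sigma> \<delta>\<^esub> m) \<odot> [:a:] = monom a m"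
proof -
  have pw: "[:0, 1:] [^]\<^bsub>ore_ring S \<sigma> \<delta>\<^esub> m = (monom 1 m :: 'a poly)"
  proof (induction m)
    case 0 show ?case by (simp add: ore_ring_def nat_pow_def)
  next
    case (Suc m)
    have "[:0, 1:] [^]\<^bsub>ore_ring S \<sigma> \<delta>\<^esub> Suc m = monom 1 m \<odot> [:0, 1:]"
      using Suc by (simp add: ore_ring_def nat_pow_def)
    also have "\<dots> = R ((R ^^ m) 1)" by (simp add: mult_pCons mult_const R_pow)
    also have "\<dots> = monom 1 (Suc m)" using R_pow[of "Suc m"] by simp
    finally show ?case .
  qed
  show ?thesis by (simp add: pw mult_const smult_monom)
qed

text \<open>The universal property: the algebra generated by \<open>S\<close> and \<open>X\<close> subject to the relation.\<close>

theorem ore_universal: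
  fixes T :: "('b, 'c) ring_scheme" (structure)
  assumes T: "ring T" and f: "f \<in> ring_hom (fun_ring S) T" and x: "x \<in> carrier T"
    and rel: "\<And>a. a \<in> S \<Longrightarrow> f a \<otimes> x = x \<otimes> f (\<sigma> a) \<oplus> f (\<delta> a)"
  shows "\<exists>g \<in> ring_hom (ore_ring S \<sigma> \<delta>) T. (\<forall>a\<in>S. g [:a:] = f a) \<and> g [:0, 1:] = x"
    and "\<And>g g' h. g \<in> ring_hom (ore_ring S \<sigma> \<delta>) T \<Longrightarrow> g' \<in> ring_hom (ore_ring S \<sigma> \<delta>) T \<Longrightarrow>
      (\<And>a. a \<in> S \<Longrightarrow> g [:a:] = g' [:a:]) \<Longrightarrow> g [:0, 1:] = g' [:0, 1:] \<Longrightarrow>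
      h \<in> carrier (ore_ring S \<sigma> \<delta>) \<Longrightarrow> g h = g' h"
proof -
  interpret T: ring T by (rule T)
  have fc [simp]: "a \<in> S \<Longrightarrow> f a \<in> carrier T" for a
    using ring_hom_closed[OF f, of a] by (simp add: fun_ring_def)
  have fadd: "a \<in> S \<Longrightarrow> b \<in> S \<Longrightarrow> f (a + b) = f a \<oplus> f b" for a b
    using ring_hom_add[OF f, of a b] by (simp add: fun_ring_def)
  have fmult: "a \<in> S \<Longrightarrow> b \<in> S \<Longrightarrow> f (a * b) = f a \<otimes> f b" for a b
    using ring_hom_mult[OF f, of a b] by (simp add: fun_ring_def)
  have f1: "f 1 = \<one>" using ring_hom_one[OF f] by (simp add: fun_ring_def)
  have f0: "f 0 = \<zero>"
    using fadd[of 0 0] T.add.r_cancel_one[of "f 0" "f 0"] by simp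
  note [simp] = x
  define g where "g h = foldr (\<lambda>a r. f a \<oplus> x \<otimes> r) (coeffs h) \<zero>" for h
  have g0 [simp]: "g 0 = \<zero>" by (simp add: g_def)
  have gp: "g (pCons a h) = f a \<oplus> x \<otimes> g h" for a h
    by (cases "a = 0 \<and> h = 0") (auto simp: g_def cCons_def f0)
  have gc [simp]: "h \<in> C \<Longrightarrow> g h \<in> carrier T" for h
    by (induction h) (simp_all add: gp del: mem_Collect_eq)
  have gadd: "h \<in> C \<Longrightarrow> k \<in> C \<Longrightarrow> g (h + k) = g h \<oplus> g k" for h k
  proof (induction h k rule: poly_induct2)
    case (pCons a h b k)
    have c: "h \<in> C" "k \<in> C" "a \<in> S" "b \<in> S"
      using pCons.prems by (simp_all del: mem_Collect_eq)
    note IH = pCons.IH[OF c(1,2)]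
    note [simp] = gc[OF c(1)] gc[OF c(2)] c(3,4)
    show ?case by (simp add: gp IH fadd T.ring_simprules)
  qed simp
  have gs: "a \<in> S \<Longrightarrow> h \<in> C \<Longrightarrow> g (smult a h) = g h \<otimes> f a" for a h
  proof (induction h)
    case (pCons b h)
    have c: "h \<in> C" "a \<in> S" "b \<in> S"
      using pCons.prems by (simp_all del: mem_Collect_eq)
    note IH = pCons.IH[OF c(2,1)]
    note [simp] = gc[OF c(1)] c(2,3)
    have "f (a * b) = f b \<otimes> f a" using fmult[of b a] by (simp add: mult.commute)
    then show ?case by (simp add: gp IH T.ring_simprules)
  qed simp
  have gR: "h \<in> C \<Longrightarrow> g (R h) = g h \<otimes> x" for h
  proof (induction h)
    case (pCons b h)
    have c: "h \<in> C" "b \<in> S" using pCons.prems by (simp_all del: mem_Collect_eq)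
    have "R (pCons b h) = [:\<delta> b:] + pCons 0 ([:\<sigma> b:] + R h)"
      by (simp add: ore_rmul_def map_poly_pCons_\<sigma> map_poly_pCons_\<delta>)
    moreover have "g ([:\<sigma> b:] + R h) = f (\<sigma> b) \<oplus> g h \<otimes> x"
      using c pCons.IH[OF c(1)] gadd[of "[:\<sigma> b:]" "R h"] R_C[OF c(1)]
      by (simp add: gp del: mem_Collect_eq)
    ultimately have "g (R (pCons b h)) = f (\<delta> b) \<oplus> x \<otimes> (f (\<sigma> b) \<oplus> g h \<otimes> x)"
      by (simp add: gp)
    also have "\<dots> = (f b \<oplus> x \<otimes> g h) \<otimes> x"
      using c gc[OF c(1)] rel[OF c(2)] by (simp del: mem_Collect_eq add: T.ring_simprules)
    finally show ?case by (simp add: gp)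
  qed simp
  have gm: "h \<in> C \<Longrightarrow> k \<in> C \<Longrightarrow> g (h \<odot> k) = g h \<otimes> g k" for h k
  proof (induction k arbitrary: h)
    case (pCons b k)
    have c: "k \<in> C" "b \<in> S" using pCons.prems by (simp_all del: mem_Collect_eq)
    have "g (h \<odot> pCons b k) = g (smult b h) \<oplus> g (R h \<odot> k)"
      unfolding mult_pCons
      by (rule gadd[OF smult_C[OF c(2) pCons.prems(1)] mult_C[OF R_C[OF pCons.prems(1)] c(1)]])
    also have "\<dots> = g h \<otimes> f b \<oplus> (g h \<otimes> x) \<otimes> g k"
      by (simp only: gs[OF c(2) pCons.prems(1)] pCons.IH[OF R_C[OF pCons.prems(1)] c(1)]
          gR[OF pCons.prems(1)])
    also have "\<dots> = g h \<otimes> g (pCons b k)"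
      using c gc[OF c(1)] gc[OF pCons.prems(1)]
      by (simp add: gp T.ring_simprules del: mem_Collect_eq)
    finally show ?case .
  qed simp
  have g1: "g 1 = \<one>" by (simp add: one_pCons gp f1)
  have "g \<in> ring_hom (ore_ring S \<sigma> \<delta>) T"
    by (rule ring_hom_memI) (use gc gm gadd g1 in \<open>auto simp: ore_ring_def\<close>)
  moreover have "\<forall>a\<in>S. g [:a:] = f a" "g [:0, 1:] = x"
    by (auto simp: gp f0 f1)
  ultimately show "\<exists>g \<in> ring_hom (ore_ring S \<sigma> \<delta>) T. (\<forall>a\<in>S. g [:a:] = f a) \<and> g [:0, 1:] = x"
    by blast
next
  fix g g' h
  assume g: "g \<in> ring_hom (ore_ring S \<sigma> \<delta>) T" and g': "g' \<in> ring_hom (ore_ring S \<sigma> \<delta>) T"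
    and eq: "\<And>a. a \<in> S \<Longrightarrow> g [:a:] = g' [:a:]" and eqX: "g [:0, 1:] = g' [:0, 1:]"
    and "h \<in> carrier (ore_ring S \<sigma> \<delta>)"
  then have "h \<in> C" by (simp add: ore_ring_def)
  then show "g h = g' h"
  proof (induction h)
    case 0
    then show ?case using eq[of 0] by simp
  next
    case (pCons b k)
    have c: "k \<in> C" "b \<in> S" "[:b:] \<in> C" "[:0, 1:] \<in> C"
      using pCons.prems by (simp_all del: mem_Collect_eq)
    have X: "[:0, 1:] \<odot> k = pCons 0 k"
    proof -
      have "[:0, 1:] \<odot> k = R 1 \<odot> k" by (simp add: R_1)
      also have "\<dots> = 1 \<odot> pCons 0 k" by (simp add: mult_pCons del: mult_1_left)
      finally show ?thesis by simp
    qed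
    have dec: "pCons b k = [:b:] \<oplus>\<^bsub>ore_ring S \<sigma> \<delta>\<^esub> [:0, 1:] \<otimes>\<^bsub>ore_ring S \<sigma> \<delta>\<^esub> k"
      by (simp add: ore_ring_def X)
    have carr: "p \<in> C \<Longrightarrow> p \<in> carrier (ore_ring S \<sigma> \<delta>)" for p by (simp add: ore_ring_def)
    have m: "[:0, 1:] \<otimes>\<^bsub>ore_ring S \<sigma> \<delta>\<^esub> k \<in> carrier (ore_ring S \<sigma> \<delta>)"
      using mult_C[OF c(4,1)] by (simp add: ore_ring_def)
    show ?case
      unfolding dec ring_hom_add[OF g carr[OF c(3)] m] ring_hom_add[OF g' carr[OF c(3)] m]
        ring_hom_mult[OF g carr[OF c(4)] carr[OF c(1)]] ring_hom_mult[OF g' carr[OF c(4)] carr[OF c(1)]]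
      using eq[OF c(2)] eqX pCons.IH[OF c(1)] by simp
  qed
qed

end


section \<open>The algebra \<open>U\<^sub>\<lambda>(iso\<^sub>\<omega>(2))\<close>\<close>

type_synonym plane_fun = "real \<times> real \<Rightarrow> complex"

inductive_set Lalg :: "real \<Rightarrow> plane_fun set" for lam :: real where
  Lalg_const: "(\<lambda>_. c) \<in> Lalg lam"
| Lalg_P1: "(\<lambda>(x, y). complex_of_real x) \<in> Lalg lam"
| Lalg_P2: "(\<lambda>(x, y). complex_of_real y) \<in> Lalg lam"
| Lalg_exp: "(\<lambda>(x, y). complex_of_real (exp (lam * y))) \<in> Lalg lam"
| Lalg_exp_minus: "(\<lambda>(x, y). complex_of_real (exp (- (lam * y)))) \<in> Lalg lam"
| Lalg_add: "l \<in> Lalg lam \<Longrightarrow> l' \<in> Lalg lam \<Longrightarrow> l + l' \<in> Lalg lam"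
| Lalg_mult: "l \<in> Lalg lam \<Longrightarrow> l' \<in> Lalg lam \<Longrightarrow> l * l' \<in> Lalg lam"

definition pd1 :: "plane_fun \<Rightarrow> plane_fun" where
  "pd1 l = (\<lambda>(x, y). vector_derivative (\<lambda>t. l (t, y)) (at x))"

definition pd2 :: "plane_fun \<Rightarrow> plane_fun" where
  "pd2 l = (\<lambda>(x, y). vector_derivative (\<lambda>t. l (x, t)) (at y))"

definition Jhat :: "real \<Rightarrow> real \<Rightarrow> plane_fun \<Rightarrow> plane_fun" where
  "Jhat \<omega> lam l = (\<lambda>(x, y).
     - complex_of_real ((1 - exp (- 2 * lam * y)) / (2 * lam) + 1 / 2 * lam * \<omega> * x\<^sup>2) * pd1 l (x, y)
     + complex_of_real (\<omega> * x) * pd2 l (x, y))"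

text \<open>\<open>[l, J] = Jhat l\<close>, so that \<open>\<sigma>\<close> is the identity; \<open>[:l:]\<close> is the element \<open>l\<close> and \<open>[:0, 1:]\<close>
  the element \<open>J\<close>.  The complex scalars are the constant functions.\<close>

definition U_iso :: "real \<Rightarrow> real \<Rightarrow> plane_fun poly ring" where
  "U_iso \<omega> lam = ore_ring (Lalg lam) (\<lambda>l. l) (Jhat \<omega> lam)"


definition has_pd :: "plane_fun \<Rightarrow> plane_fun \<Rightarrow> plane_fun \<Rightarrow> bool" where
  "has_pd l d1 d2 \<longleftrightarrow>
    (\<forall>x y. ((\<lambda>t. l (t, y)) has_vector_derivative d1 (x, y)) (at x) \<and>
           ((\<lambda>t. l (x, t)) has_vector_derivative d2 (x, y)) (at y))"

lemma has_pd_pd: "has_pd l d1 d2 \<Longrightarrow> pd1 l = d1" "has_pd l d1 d2 \<Longrightarrow> pd2 l = d2"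
  by (auto simp: has_pd_def pd1_def pd2_def fun_eq_iff intro!: vector_derivative_at)

lemma has_pd_add: "has_pd l a b \<Longrightarrow> has_pd l' a' b' \<Longrightarrow> has_pd (l + l') (a + a') (b + b')"
  unfolding has_pd_def by (auto intro!: derivative_eq_intros)

lemma has_pd_mult:
  "has_pd l a b \<Longrightarrow> has_pd l' a' b' \<Longrightarrow> has_pd (l * l') (a * l' + l * a') (b * l' + l * b')"
  unfolding has_pd_def
  by (auto intro!: derivative_eq_intros simp: algebra_simps)

lemma has_pd_const: "has_pd (\<lambda>_. c) 0 0"
  by (auto simp: has_pd_def)

lemma has_pd_P1: "has_pd (\<lambda>(x, y). complex_of_real x) 1 0"
  unfolding has_pd_def
  by (auto intro!: derivative_eq_intros has_vector_derivative_of_real)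

lemma has_pd_P2: "has_pd (\<lambda>(x, y). complex_of_real y) 0 1"
  unfolding has_pd_def
  by (auto intro!: derivative_eq_intros has_vector_derivative_of_real)

lemma has_pd_exp:
  "has_pd (\<lambda>(x, y). complex_of_real (exp (c * y))) 0
     (\<lambda>(x, y). complex_of_real (c * exp (c * y)))"
  unfolding has_pd_def
  by (auto intro!: derivative_eq_intros has_vector_derivative_of_real
      simp: mult.commute simp flip: has_real_derivative_iff_has_vector_derivative)

lemma Lalg_0 [simp]: "0 \<in> Lalg lam" using Lalg_const[of 0] by (simp add: zero_fun_def)
lemma Lalg_1 [simp]: "1 \<in> Lalg lam" using Lalg_const[of 1] by (simp add: one_fun_def)

lemma Lalg_scale: "l \<in> Lalg lam \<Longrightarrow> (\<lambda>p. c * l p) \<in> Lalg lam"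
  using Lalg_mult[OF Lalg_const[of c]] by (simp add: times_fun_def)

lemma Lalg_uminus: "l \<in> Lalg lam \<Longrightarrow> - l \<in> Lalg lam"
  using Lalg_scale[of l lam "-1"] by (simp add: fun_Compl_def)

lemma Lalg_has_pd: "l \<in> Lalg lam \<Longrightarrow> \<exists>a\<in>Lalg lam. \<exists>b\<in>Lalg lam. has_pd l a b"
proof (induction rule: Lalg.induct)
  case (Lalg_const c)
  have "has_pd (\<lambda>_. c) 0 0" by (rule has_pd_const)
  then show ?case using Lalg_0 by blast
next
  case Lalg_P1
  show ?case using has_pd_P1 Lalg_0 Lalg_1 by blast
next
  case Lalg_P2
  show ?case using has_pd_P2 Lalg_0 Lalg_1 by blast
next
  case Lalg_exp
  have "(\<lambda>(x, y). complex_of_real (lam * exp (lam * y))) \<in> Lalg lam"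
    using Lalg_scale[OF Lalg.Lalg_exp, of "of_real lam"] by (simp add: case_prod_unfold)
  then show ?case using has_pd_exp[of lam] Lalg_0 by blast
next
  case Lalg_exp_minus
  have "(\<lambda>(x, y). complex_of_real ((- lam) * exp ((- lam) * y))) \<in> Lalg lam"
    using Lalg_scale[OF Lalg.Lalg_exp_minus, of "of_real (- lam)"] by (simp add: case_prod_unfold)
  then show ?case using has_pd_exp[of "- lam"] Lalg_0 by fastforce
next
  case (Lalg_add l l')
  then obtain a b a' b' where "a \<in> Lalg lam" "b \<in> Lalg lam" "a' \<in> Lalg lam" "b' \<in> Lalg lam"
    and h: "has_pd l a b" "has_pd l' a' b'" by blast
  then have "a + a' \<in> Lalg lam" "b + b' \<in> Lalg lam" by (simp_all only: Lalg.Lalg_add)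
  then show ?case using has_pd_add[OF h] by blast
next
  case (Lalg_mult l l')
  then obtain a b a' b' where "a \<in> Lalg lam" "b \<in> Lalg lam" "a' \<in> Lalg lam" "b' \<in> Lalg lam"
    and h: "has_pd l a b" "has_pd l' a' b'" by blast
  then have "a * l' + l * a' \<in> Lalg lam" "b * l' + l * b' \<in> Lalg lam"
    using Lalg_mult.hyps by (simp_all only: Lalg.Lalg_add Lalg.Lalg_mult)
  then show ?case using has_pd_mult[OF h] by blast
qed

lemma Lalg_pd:
  assumes "l \<in> Lalg lam"
  shows "pd1 l \<in> Lalg lam" "pd2 l \<in> Lalg lam" "has_pd l (pd1 l) (pd2 l)"
proof -
  obtain a b where ab: "a \<in> Lalg lam" "b \<in> Lalg lam" "has_pd l a b"
    using Lalg_has_pd[OF assms] by blast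
  then show "pd1 l \<in> Lalg lam" "pd2 l \<in> Lalg lam" "has_pd l (pd1 l) (pd2 l)"
    using has_pd_pd[OF ab(3)] by simp_all
qed

lemma pd_add:
  assumes "l \<in> Lalg lam" "l' \<in> Lalg lam"
  shows "pd1 (l + l') = pd1 l + pd1 l'" "pd2 (l + l') = pd2 l + pd2 l'"
  using has_pd_pd[OF has_pd_add[OF Lalg_pd(3)[OF assms(1)] Lalg_pd(3)[OF assms(2)]]] by auto

lemma pd_mult:
  assumes "l \<in> Lalg lam" "l' \<in> Lalg lam"
  shows "pd1 (l * l') = pd1 l * l' + l * pd1 l'" "pd2 (l * l') = pd2 l * l' + l * pd2 l'"
  using has_pd_pd[OF has_pd_mult[OF Lalg_pd(3)[OF assms(1)] Lalg_pd(3)[OF assms(2)]]] by auto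

lemma pd_0: "pd1 0 = 0" "pd2 0 = 0"
  using has_pd_pd[OF has_pd_const[of 0]] by (simp_all add: zero_fun_def)

lemma pd_commute_exp:
  "pd1 (pd2 (\<lambda>(x, y). complex_of_real (exp (c * y)))) =
   pd2 (pd1 (\<lambda>(x, y). complex_of_real (exp (c * y))))"
proof -
  have "has_pd (\<lambda>(x, y). complex_of_real (c * exp (c * y))) 0
     (\<lambda>(x, y). complex_of_real (c * (c * exp (c * y))))"
    unfolding has_pd_def
    by (auto intro!: derivative_eq_intros has_vector_derivative_of_real
      simp: mult.commute simp flip: has_real_derivative_iff_has_vector_derivative)
  from has_pd_pd(1)[OF this] show ?thesis
    by (simp only: has_pd_pd[OF has_pd_exp[of c]] pd_0)
qed

lemma pd_commute: "l \<in> Lalg lam \<Longrightarrow> pd1 (pd2 l) = pd2 (pd1 l)"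
proof (induction rule: Lalg.induct)
  case (Lalg_const c)
  then show ?case using has_pd_pd[OF has_pd_const] by (simp add: zero_fun_def)
next
  case Lalg_P1
  then show ?case using has_pd_pd[OF has_pd_P1] has_pd_pd[OF has_pd_const]
    by (simp add: zero_fun_def one_fun_def)
next
  case Lalg_P2
  then show ?case using has_pd_pd[OF has_pd_P2] has_pd_pd[OF has_pd_const]
    by (simp add: zero_fun_def one_fun_def)
next
  case Lalg_exp
  show ?case using pd_commute_exp[of lam] by simp
next
  case Lalg_exp_minus
  show ?case using pd_commute_exp[of "- lam"] by simp
next
  case (Lalg_add l l')
  note L = Lalg_add.hyps
  note d = Lalg_pd(1)[OF L(1)] Lalg_pd(2)[OF L(1)] Lalg_pd(1)[OF L(2)] Lalg_pd(2)[OF L(2)]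
  show ?case
    by (simp only: pd_add[OF L] pd_add[OF d(2,4)] pd_add[OF d(1,3)] Lalg_add.IH)
next
  case (Lalg_mult l l')
  note L = Lalg_mult.hyps
  note d = Lalg_pd(1)[OF L(1)] Lalg_pd(2)[OF L(1)] Lalg_pd(1)[OF L(2)] Lalg_pd(2)[OF L(2)]
  show ?case
    by (simp only: pd_mult[OF L] pd_add[OF Lalg.Lalg_mult[OF d(2) L(2)] Lalg.Lalg_mult[OF L(1) d(4)]]
        pd_add[OF Lalg.Lalg_mult[OF d(1) L(2)] Lalg.Lalg_mult[OF L(1) d(3)]]
        pd_mult[OF d(2) L(2)] pd_mult[OF L(1) d(4)] pd_mult[OF d(1) L(2)] pd_mult[OF L(1) d(3)]
        Lalg_mult.IH) (simp add: algebra_simps)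
qed

definition Jc1 :: "real \<Rightarrow> real \<Rightarrow> plane_fun" where
  "Jc1 \<omega> lam = (\<lambda>(x, y).
     - complex_of_real ((1 - exp (- 2 * lam * y)) / (2 * lam) + 1 / 2 * lam * \<omega> * x\<^sup>2))"

definition Jc2 :: "real \<Rightarrow> plane_fun" where
  "Jc2 \<omega> = (\<lambda>(x, y). complex_of_real (\<omega> * x))"

lemma Jhat_eq: "Jhat \<omega> lam l = Jc1 \<omega> lam * pd1 l + Jc2 \<omega> * pd2 l"
  by (simp add: Jhat_def Jc1_def Jc2_def fun_eq_iff)

lemma Jc_Lalg: "Jc1 \<omega> lam \<in> Lalg lam" "Jc2 \<omega> \<in> Lalg lam"
proof -
  let ?x = "\<lambda>(x::real, y::real). complex_of_real x"
  let ?e = "\<lambda>(x::real, y::real). complex_of_real (exp (- (lam * y)))"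
  have "Jc2 \<omega> = (\<lambda>_. of_real \<omega>) * ?x" by (simp add: Jc2_def times_fun_def case_prod_unfold)
  then show "Jc2 \<omega> \<in> Lalg lam" by (metis Lalg_mult Lalg_const Lalg_P1)
  define a b where "a = complex_of_real (1 / (2 * lam))" and "b = complex_of_real (1 / 2 * lam * \<omega>)"
  have e: "exp (- 2 * lam * y) = exp (- (lam * y)) * exp (- (lam * y))" for y
    by (simp add: mult_exp_exp)
  have "Jc1 \<omega> lam = (\<lambda>_. - a) + (\<lambda>_. a) * (?e * ?e) + (\<lambda>_. - b) * (?x * ?x)"
    unfolding Jc1_def e a_def b_def
    by (simp add: times_fun_def plus_fun_def case_prod_unfold diff_divide_distrib power2_eq_square)
  moreover have "\<dots> \<in> Lalg lam"
    by (intro Lalg_add Lalg_mult Lalg_const Lalg_P1 Lalg_exp_minus)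
  ultimately show "Jc1 \<omega> lam \<in> Lalg lam" by simp
qed

lemma Jhat_Lalg: "l \<in> Lalg lam \<Longrightarrow> Jhat \<omega> lam l \<in> Lalg lam"
  unfolding Jhat_eq by (intro Lalg_add Lalg_mult Jc_Lalg Lalg_pd)

theorem ore_data_U: "ore_data (Lalg lam) (\<lambda>l. l) (Jhat \<omega> lam)"
proof
  fix a b assume ab: "a \<in> Lalg lam" "b \<in> Lalg lam"
  show "Jhat \<omega> lam (a + b) = Jhat \<omega> lam a + Jhat \<omega> lam b"
    by (simp add: Jhat_eq pd_add[OF ab] algebra_simps)
  show "Jhat \<omega> lam (a * b) = a * Jhat \<omega> lam b + Jhat \<omega> lam a * b"
    by (simp add: Jhat_eq pd_mult[OF ab] algebra_simps)
qed (auto intro: Lalg_add Lalg_mult Lalg_uminus Jhat_Lalg)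

theorem ring_U_iso: "ring (U_iso \<omega> lam)"
  unfolding U_iso_def by (rule ore_data.ring_ore[OF ore_data_U])

theorem U_iso_relation:
  assumes "l \<in> Lalg lam"
  shows "[:l:] \<otimes>\<^bsub>U_iso \<omega> lam\<^esub> [:0, 1:] =
    [:0, 1:] \<otimes>\<^bsub>U_iso \<omega> lam\<^esub> [:l:] \<oplus>\<^bsub>U_iso \<omega> lam\<^esub> [:Jhat \<omega> lam l:]"
  using ore_data.ore_relation[OF ore_data_U assms] by (simp add: U_iso_def ore_ring_def)


section \<open>The dual \<open>F\<^sub>\<lambda>(ISO\<^sub>\<omega>(2))\<close> and its subalgebra \<open>\<A>\<close>\<close>

text \<open>An element \<open>\<Sum>r. a\<^sub>1^r f\<^sub>r(a\<^sub>2)\<close> of \<open>\<A>\<close> has the coefficients \<open>f\<^sub>r\<close>; the relation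
  \<open>[a\<^sub>1, a\<^sub>2] = \<lambda> a\<^sub>1\<close> reads \<open>f(a\<^sub>2) a\<^sub>1 = a\<^sub>1 f(a\<^sub>2 - \<lambda>)\<close>.\<close>

type_synonym A_elem = "complex poly poly"

definition A_iso :: "real \<Rightarrow> A_elem ring" where
  "A_iso lam = ore_ring UNIV (\<lambda>p. p \<circ>\<^sub>p [:- complex_of_real lam, 1:]) (\<lambda>_. 0)"

theorem ore_data_A: "ore_data UNIV (\<lambda>p. p \<circ>\<^sub>p [:- complex_of_real lam, 1:]) (\<lambda>_. 0)"
  by unfold_locales (auto simp: pcompose_add pcompose_mult pcompose_1)

theorem ring_A_iso: "ring (A_iso lam)"
  unfolding A_iso_def by (rule ore_data.ring_ore[OF ore_data_A])

abbreviation a1 :: A_elem where "a1 \<equiv> [:0, 1:]"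
abbreviation a2 :: A_elem where "a2 \<equiv> [:[:0, 1:]:]"

theorem A_iso_relation:
  "a1 \<otimes>\<^bsub>A_iso lam\<^esub> a2 \<ominus>\<^bsub>A_iso lam\<^esub> a2 \<otimes>\<^bsub>A_iso lam\<^esub> a1 = smult [:complex_of_real lam:] a1"
proof -
  interpret r: ring "A_iso lam" by (rule ring_A_iso)
  have c: "c \<in> carrier (A_iso lam)" for c by (simp add: A_iso_def ore_ring_def)
  have 1: "a2 \<otimes>\<^bsub>A_iso lam\<^esub> a1 = [:0, [:- complex_of_real lam, 1:]:]"
    and 2: "a1 \<otimes>\<^bsub>A_iso lam\<^esub> a2 = [:0, [:0, 1:]:]"
    using ore_data.ore_relation[OF ore_data_A, of "[:0, 1:]" lam]
    by (simp_all add: A_iso_def ore_ring_def ore_data.mult_const[OF ore_data_A] pcompose_pCons)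
  have "a1 \<otimes>\<^bsub>A_iso lam\<^esub> a2 =
      smult [:complex_of_real lam:] a1 \<oplus>\<^bsub>A_iso lam\<^esub> a2 \<otimes>\<^bsub>A_iso lam\<^esub> a1"
    unfolding 1 2 by (simp add: A_iso_def ore_ring_def one_pCons)
  then show ?thesis
    by (simp add: a_minus_def r.a_assoc r.r_neg c)
qed

text \<open>An element of \<open>F\<close> is \<open>\<Sum>q. \<phi>^q f\<^sub>q\<close> with \<open>f\<^sub>q \<in> \<A>\<close>.  Only the ordered basis and the pairing
  with \<open>U_iso\<close> enter the regular action, so just the linear structure of \<open>F\<close> is needed;
  \<open>\<A>\<close> sits in it as the constant polynomials.\<close>

type_synonym F_elem = "A_elem poly"

definition pairing :: "plane_fun poly \<Rightarrow> F_elem \<Rightarrow> complex" where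
  "pairing h F = (\<Sum>q\<le>degree F. \<Sum>r\<le>degree (coeff F q). \<Sum>s\<le>degree (coeff (coeff F q) r).
     coeff (coeff (coeff F q) r) s * fact q * ((pd1 ^^ r) ((pd2 ^^ s) (coeff h q))) (0, 0))"

text \<open>The left regular action.  Existence and uniqueness of the element described by \<open>THE\<close> are
  proved in \<open>left_act_pairing\<close> below; \<open>\<A>\<close> is stable by \<open>left_act_stable\<close>.\<close>

definition left_act :: "real \<Rightarrow> real \<Rightarrow> plane_fun poly \<Rightarrow> F_elem \<Rightarrow> F_elem" where
  "left_act \<omega> lam h F = (THE G. \<forall>h' \<in> carrier (U_iso \<omega> lam).
     pairing h' G = pairing (h' \<otimes>\<^bsub>U_iso \<omega> lam\<^esub> h) F)"


subsection \<open>Well-definedness of the pairing and of the left regular action\<close>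

definition pdD :: "nat \<Rightarrow> nat \<Rightarrow> plane_fun \<Rightarrow> complex" where
  "pdD r s l = ((pd1 ^^ r) ((pd2 ^^ s) l)) (0, 0)"

definition ev :: "A_elem \<Rightarrow> plane_fun \<Rightarrow> complex" where
  "ev f l = (\<Sum>r\<le>degree f. \<Sum>s\<le>degree (coeff f r). coeff (coeff f r) s * pdD r s l)"

lemma pairing_ev: "pairing h F = (\<Sum>q\<le>degree F. fact q * ev (coeff F q) (coeff h q))"
  by (simp add: pairing_def ev_def pdD_def sum_distrib_left mult_ac)

lemma degree_bound:
  fixes f :: "'a::zero poly poly"
  obtains M where "\<And>r. degree (coeff f r) \<le> M"
proof
  fix r
  show "degree (coeff f r) \<le> (\<Sum>r\<le>degree f. degree (coeff f r))"
    by (cases "r \<le> degree f") (auto simp: coeff_eq_0 intro: member_le_sum)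
qed

lemma ev_bound:
  assumes "degree f \<le> N" "\<And>r. degree (coeff f r) \<le> M"
  shows "ev f l = (\<Sum>r\<le>N. \<Sum>s\<le>M. coeff (coeff f r) s * pdD r s l)"
proof -
  have "(\<Sum>s\<le>degree (coeff f r). coeff (coeff f r) s * pdD r s l) =
      (\<Sum>s\<le>M. coeff (coeff f r) s * pdD r s l)" for r
    by (rule sum.mono_neutral_left) (use assms(2)[of r] in \<open>auto simp: coeff_eq_0\<close>)
  then have "ev f l = (\<Sum>r\<le>degree f. \<Sum>s\<le>M. coeff (coeff f r) s * pdD r s l)"
    by (simp add: ev_def)
  also have "\<dots> = (\<Sum>r\<le>N. \<Sum>s\<le>M. coeff (coeff f r) s * pdD r s l)"
    by (rule sum.mono_neutral_left) (use assms(1) in \<open>auto simp: coeff_eq_0\<close>)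
  finally show ?thesis .
qed

lemma ev_add: "ev (f + g) l = ev f l + ev g l"
proof -
  obtain M M' where M: "\<And>r. degree (coeff f r) \<le> M" "\<And>r. degree (coeff g r) \<le> M'"
    using degree_bound by metis
  let ?N = "max (degree f) (degree g)" and ?M = "max M M'"
  have "degree (f + g) \<le> ?N" by (rule degree_add_le_max)
  moreover have "degree (coeff (f + g) r) \<le> ?M" for r
    using degree_add_le_max[of "coeff f r" "coeff g r"] M(1)[of r] M(2)[of r]
    by (auto simp: max_def split: if_splits)
  moreover have "degree (coeff f r) \<le> ?M" "degree (coeff g r) \<le> ?M" for r
    using M(1)[of r] M(2)[of r] by auto
  ultimately show ?thesis
    by (simp add: ev_bound[of _ ?N ?M] sum.distrib distrib_right)
qed

lemma ev_0 [simp]: "ev 0 l = 0" by (simp add: ev_def)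

lemma ev_smult: "ev (smult [:c:] f) l = c * ev f l"
proof -
  obtain M where M: "\<And>r. degree (coeff f r) \<le> M" using degree_bound by metis
  have "degree (smult [:c:] f) \<le> degree f" by (rule degree_smult_le)
  moreover have "degree (coeff (smult [:c:] f) r) \<le> M" for r
    using M[of r] degree_smult_le[of c "coeff f r"] by simp
  ultimately show ?thesis
    using M by (simp add: ev_bound[of _ "degree f" M] sum_distrib_left mult.assoc)
qed

lemma ev_monom: "ev (monom (monom 1 s) r) l = pdD r s l"
proof -
  have "degree (coeff (monom (monom (1::complex) s) r) r') \<le> s" for r'
    by (simp add: degree_monom_le)
  then have "ev (monom (monom 1 s) r) l =
      (\<Sum>r'\<le>r. \<Sum>s'\<le>s. coeff (coeff (monom (monom 1 s) r) r') s' * pdD r' s' l)"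
    by (intro ev_bound degree_monom_le)
  also have "\<dots> = (\<Sum>r'\<le>r. if r = r' then pdD r s l else 0)"
    by (intro sum.cong refl) (auto simp: if_distrib[of "\<lambda>x. x * _"] cong: if_cong)
  also have "\<dots> = pdD r s l" by (simp add: sum.delta)
  finally show ?thesis .
qed

lemma pairing_bound:
  assumes "degree F \<le> N"
  shows "pairing h F = (\<Sum>q\<le>N. fact q * ev (coeff F q) (coeff h q))"
  unfolding pairing_ev
  by (rule sum.mono_neutral_left) (use assms in \<open>auto simp: coeff_eq_0\<close>)

lemma pd_funpow_Lalg:
  "l \<in> Lalg lam \<Longrightarrow> (pd1 ^^ r) l \<in> Lalg lam" "l \<in> Lalg lam \<Longrightarrow> (pd2 ^^ s) l \<in> Lalg lam"
proof -
  assume l: "l \<in> Lalg lam"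
  show "(pd1 ^^ r) l \<in> Lalg lam" by (induction r) (simp_all add: l Lalg_pd)
  show "(pd2 ^^ s) l \<in> Lalg lam" by (induction s) (simp_all add: l Lalg_pd)
qed

lemma pd_funpow_add:
  assumes "l \<in> Lalg lam" "l' \<in> Lalg lam"
  shows "(pd1 ^^ r) (l + l') = (pd1 ^^ r) l + (pd1 ^^ r) l'"
    and "(pd2 ^^ r) (l + l') = (pd2 ^^ r) l + (pd2 ^^ r) l'"
  by (induction r) (simp_all add: pd_add pd_funpow_Lalg[OF assms(1)] pd_funpow_Lalg[OF assms(2)]
      pd_add(1)[OF pd_funpow_Lalg(1)[OF assms(1)] pd_funpow_Lalg(1)[OF assms(2)]]
      pd_add(2)[OF pd_funpow_Lalg(2)[OF assms(1)] pd_funpow_Lalg(2)[OF assms(2)]])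

lemma pdD_add: "l \<in> Lalg lam \<Longrightarrow> l' \<in> Lalg lam \<Longrightarrow> pdD r s (l + l') = pdD r s l + pdD r s l'"
  by (simp add: pdD_def pd_funpow_add(2)[of l lam l']
      pd_funpow_add(1)[OF pd_funpow_Lalg(2)[of l lam] pd_funpow_Lalg(2)[of l' lam]])

lemma pd2_funpow_pd1: "l \<in> Lalg lam \<Longrightarrow> (pd2 ^^ s) (pd1 l) = pd1 ((pd2 ^^ s) l)"
  by (induction s) (simp_all add: pd_commute[OF pd_funpow_Lalg(2)])

lemma pdD_pd:
  "l \<in> Lalg lam \<Longrightarrow> pdD r s (pd1 l) = pdD (Suc r) s l"
  "pdD r s (pd2 l) = pdD r (Suc s) l"
  by (simp_all add: pdD_def pd2_funpow_pd1 funpow_swap1)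

text \<open>The functionals on \<open>Lalg lam\<close> represented by elements of \<open>\<A>\<close>.\<close>

definition repr :: "real \<Rightarrow> (plane_fun \<Rightarrow> complex) \<Rightarrow> bool" where
  "repr lam w \<longleftrightarrow> (\<exists>f. \<forall>l\<in>Lalg lam. ev f l = w l)"

lemma repr_add: "repr lam w \<Longrightarrow> repr lam w' \<Longrightarrow> repr lam (\<lambda>l. w l + w' l)"
  unfolding repr_def by (metis ev_add)

lemma repr_scale: "repr lam w \<Longrightarrow> repr lam (\<lambda>l. c * w l)"
  unfolding repr_def by (metis ev_smult)

lemma repr_0: "repr lam (\<lambda>l. 0)"
  unfolding repr_def by (rule exI[of _ 0]) simp

lemma repr_sum: "(\<And>i. i \<in> I \<Longrightarrow> repr lam (w i)) \<Longrightarrow> repr lam (\<lambda>l. \<Sum>i\<in>I. w i l)"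
proof (induction I rule: infinite_finite_induct)
  case (insert i I)
  then show ?case using repr_add[of lam "w i" "\<lambda>l. \<Sum>i\<in>I. w i l"] by simp
qed (simp_all add: repr_0)

lemma repr_pdD: "repr lam (pdD r s)"
  unfolding repr_def by (rule exI[of _ "monom (monom 1 s) r"]) (simp add: ev_monom)

lemma repr_cong: "(\<And>l. l \<in> Lalg lam \<Longrightarrow> w l = w' l) \<Longrightarrow> repr lam w \<longleftrightarrow> repr lam w'"
  unfolding repr_def by auto

lemma repr_comp:
  assumes "\<And>r s. repr lam (\<lambda>l. pdD r s (T l))"
  shows "repr lam (\<lambda>l. ev f (T l))"
  unfolding ev_def by (intro repr_sum repr_scale assms)

lemma repr_pd:
  assumes "repr lam w"
  shows "repr lam (\<lambda>l. w (pd1 l))" "repr lam (\<lambda>l. w (pd2 l))"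
proof -
  obtain f where f: "\<And>l. l \<in> Lalg lam \<Longrightarrow> ev f l = w l"
    using assms unfolding repr_def by auto
  have "repr lam (\<lambda>l. pdD r s (pd1 l))" for r s
    using repr_pdD[of lam "Suc r" s] by (subst repr_cong[OF pdD_pd(1)])
  from repr_comp[of lam pd1, OF this] show "repr lam (\<lambda>l. w (pd1 l))"
    by (subst repr_cong[OF f[symmetric]]) (auto simp: Lalg_pd)
  have "repr lam (\<lambda>l. pdD r s (pd2 l))" for r s
    using repr_pdD[of lam r "Suc s"] by (simp add: pdD_pd)
  from repr_comp[of lam pd2, OF this] show "repr lam (\<lambda>l. w (pd2 l))"
    by (subst repr_cong[OF f[symmetric]]) (auto simp: Lalg_pd)
qed

lemma repr_pdD_mult: "u \<in> Lalg lam \<Longrightarrow> repr lam (\<lambda>l. pdD r s (u * l))"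
proof (induction r arbitrary: u)
  case 0
  then show ?case
  proof (induction s arbitrary: u)
    case 0
    show ?case using repr_scale[OF repr_pdD[of lam 0 0], of "u (0, 0)"] by (simp add: pdD_def)
  next
    case (Suc s)
    note pu = Lalg_pd(2)[OF Suc.prems]
    have "pdD 0 (Suc s) (u * l) = pdD 0 s (pd2 u * l) + pdD 0 s (u * pd2 l)"
      if l: "l \<in> Lalg lam" for l
      using pdD_add[OF Lalg_mult[OF pu l] Lalg_mult[OF Suc.prems Lalg_pd(2)[OF l]], of 0 s]
      by (simp add: pd_mult(2)[OF Suc.prems l] flip: pdD_pd(2))
    moreover have "repr lam (\<lambda>l. pdD 0 s (pd2 u * l) + pdD 0 s (u * pd2 l))"
      by (rule repr_add[OF Suc.IH[OF pu] repr_pd(2)[OF Suc.IH[OF Suc.prems]]])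
    ultimately show ?case by (subst repr_cong)
  qed
next
  case (Suc r)
  note pu = Lalg_pd(1)[OF Suc.prems]
  have "pdD (Suc r) s (u * l) = pdD r s (pd1 u * l) + pdD r s (u * pd1 l)"
    if l: "l \<in> Lalg lam" for l
    using pdD_add[OF Lalg_mult[OF pu l] Lalg_mult[OF Suc.prems Lalg_pd(1)[OF l]], of r s]
    by (simp add: pd_mult(1)[OF Suc.prems l] pdD_pd(1)[OF Lalg_mult[OF Suc.prems l], symmetric])
  moreover have "repr lam (\<lambda>l. pdD r s (pd1 u * l) + pdD r s (u * pd1 l))"
    by (rule repr_add[OF Suc.IH[OF pu] repr_pd(1)[OF Suc.IH[OF Suc.prems]]])
  ultimately show ?case by (subst repr_cong)
qed

lemma repr_ev_mult: "u \<in> Lalg lam \<Longrightarrow> repr lam (\<lambda>l. ev f (u * l))"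
  by (intro repr_comp repr_pdD_mult)

lemma ev_add_right: "l \<in> Lalg lam \<Longrightarrow> l' \<in> Lalg lam \<Longrightarrow> ev f (l + l') = ev f l + ev f l'"
  by (simp add: ev_def pdD_add distrib_left sum.distrib)

lemma ev_zero_right: "ev f 0 = 0"
  using ev_add_right[of 0 0 0 f] by simp

lemma pairing_add_left:
  assumes "h \<in> carrier (U_iso \<omega> lam)" "h' \<in> carrier (U_iso \<omega> lam)"
  shows "pairing (h + h') F = pairing h F + pairing h' F"
proof -
  have "ev f (coeff h q + coeff h' q) = ev f (coeff h q) + ev f (coeff h' q)" for f q
    using assms by (intro ev_add_right[of _ lam]) (auto simp: U_iso_def ore_ring_def)
  then show ?thesis by (simp add: pairing_ev distrib_left sum.distrib)
qed

lemma pairing_add_right: "pairing h (F + G) = pairing h F + pairing h G"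
proof -
  let ?N = "max (degree F) (degree G)"
  have "degree (F + G) \<le> ?N" by (rule degree_add_le_max)
  then show ?thesis
    by (simp add: pairing_bound[of _ ?N] ev_add distrib_left sum.distrib)
qed

lemma build_F:
  assumes "\<And>q. repr lam (w q)"
  obtains G where "degree G \<le> N"
    "\<And>h. h \<in> carrier (U_iso \<omega> lam) \<Longrightarrow> pairing h G = (\<Sum>q\<le>N. fact q * w q (coeff h q))"
proof -
  obtain g where g: "\<And>q l. l \<in> Lalg lam \<Longrightarrow> ev (g q) l = w q l"
    using assms unfolding repr_def by metis
  define G where "G = (\<Sum>q\<le>N. monom (g q) q)"
  have c: "coeff G q = (if q \<le> N then g q else 0)" for q
    by (simp add: G_def coeff_sum)
  have "degree G \<le> N" by (rule degree_le) (simp add: c)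
  moreover have "pairing h G = (\<Sum>q\<le>N. fact q * w q (coeff h q))"
    if "h \<in> carrier (U_iso \<omega> lam)" for h
    using that by (simp add: pairing_bound[OF \<open>degree G \<le> N\<close>] c g U_iso_def ore_ring_def)
  ultimately show ?thesis by (rule that)
qed

lemma exists_smult:
  assumes "u \<in> Lalg lam"
  shows "\<exists>G. degree G \<le> degree F \<and>
    (\<forall>h \<in> carrier (U_iso \<omega> lam). pairing h G = pairing (smult u h) F)"
proof -
  obtain G where "degree G \<le> degree F" "\<And>h. h \<in> carrier (U_iso \<omega> lam) \<Longrightarrow>
      pairing h G = (\<Sum>q\<le>degree F. fact q * ev (coeff F q) (u * coeff h q))"
    using build_F[of lam "\<lambda>q l. ev (coeff F q) (u * l)", OF repr_ev_mult[OF assms]] by blast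
  then show ?thesis by (auto simp: pairing_ev)
qed

lemma exists_J:
  "\<exists>G. degree G \<le> degree F \<and> (\<forall>h \<in> carrier (U_iso \<omega> lam).
     pairing h G = pairing (ore_rmul (\<lambda>l. l) (Jhat \<omega> lam) h) F)"
proof -
  let ?N = "degree F"
  define w where "w q l = of_nat (Suc q) * ev (coeff F (Suc q)) l + ev (coeff F q) (Jhat \<omega> lam l)"
    for q l
  have r1: "repr lam (ev f)" for f unfolding repr_def by blast
  have J: "ev f (Jhat \<omega> lam l) = ev f (Jc1 \<omega> lam * pd1 l) + ev f (Jc2 \<omega> * pd2 l)"
    if "l \<in> Lalg lam" for f l
    unfolding Jhat_eq
    by (rule ev_add_right[OF Lalg_mult[OF Jc_Lalg(1) Lalg_pd(1)[OF that]]
          Lalg_mult[OF Jc_Lalg(2) Lalg_pd(2)[OF that]]])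
  have "repr lam (\<lambda>l. ev f (Jc1 \<omega> lam * pd1 l) + ev f (Jc2 \<omega> * pd2 l))" for f
    by (rule repr_add[OF repr_pd(1)[OF repr_ev_mult[OF Jc_Lalg(1)]]
          repr_pd(2)[OF repr_ev_mult[OF Jc_Lalg(2)]]])
  then have r2: "repr lam (\<lambda>l. ev f (Jhat \<omega> lam l))" for f
    by (subst repr_cong[OF J])
  have "repr lam (w q)" for q
    unfolding w_def[abs_def] by (rule repr_add[OF repr_scale[OF r1] r2])
  then obtain G where G: "degree G \<le> ?N" "\<And>h. h \<in> carrier (U_iso \<omega> lam) \<Longrightarrow>
      pairing h G = (\<Sum>q\<le>?N. fact q * w q (coeff h q))"
    using build_F[of lam w] by blast
  have "pairing (ore_rmul (\<lambda>l. l) (Jhat \<omega> lam) h) F = (\<Sum>q\<le>?N. fact q * w q (coeff h q))"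
    if h: "h \<in> carrier (U_iso \<omega> lam)" for h
  proof -
    have L: "coeff h q \<in> Lalg lam" for q using h by (simp add: U_iso_def ore_ring_def)
    have J0: "Jhat \<omega> lam 0 = 0" by (simp add: Jhat_eq pd_0)
    have c: "coeff (ore_rmul (\<lambda>l. l) (Jhat \<omega> lam) h) q =
        (case q of 0 \<Rightarrow> 0 | Suc q' \<Rightarrow> coeff h q') + Jhat \<omega> lam (coeff h q)" for q
      by (simp add: ore_rmul_def coeff_map_poly J0 coeff_pCons split: nat.splits)
    have L': "(case q of 0 \<Rightarrow> 0 | Suc q' \<Rightarrow> coeff h q') \<in> Lalg lam" for q
      by (simp add: L split: nat.splits)
    let ?t = "\<lambda>q. fact q * ev (coeff F q) (case q of 0 \<Rightarrow> 0 | Suc q' \<Rightarrow> coeff h q')"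
    let ?s = "\<Sum>q\<le>?N. fact q * ev (coeff F q) (Jhat \<omega> lam (coeff h q))"
    have "pairing (ore_rmul (\<lambda>l. l) (Jhat \<omega> lam) h) F = (\<Sum>q\<le>?N. ?t q) + ?s"
      by (simp add: pairing_ev c ev_add_right[OF L' Jhat_Lalg[OF L]] distrib_left sum.distrib)
    also have "(\<Sum>q\<le>?N. ?t q) = (\<Sum>q\<le>Suc ?N. ?t q)" by (simp add: coeff_eq_0)
    also have "\<dots> = (\<Sum>q\<le>?N. ?t (Suc q))"
      by (subst sum.atMost_Suc_shift) (simp add: ev_zero_right)
    also have "\<dots> + ?s = (\<Sum>q\<le>?N. fact q * w q (coeff h q))"
      by (simp add: w_def sum.distrib algebra_simps)
    finally show ?thesis .
  qed
  then show ?thesis using G by auto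
qed

lemma left_act_exists:
  assumes "k \<in> carrier (U_iso \<omega> lam)"
  shows "\<exists>G. degree G \<le> degree F \<and>
    (\<forall>h \<in> carrier (U_iso \<omega> lam). pairing h G = pairing (h \<otimes>\<^bsub>U_iso \<omega> lam\<^esub> k) F)"
proof -
  interpret U: ring "U_iso \<omega> lam" by (rule ring_U_iso)
  let ?R = "ore_rmul (\<lambda>l. l) (Jhat \<omega> lam)" and ?m = "ore_mult (\<lambda>l. l) (Jhat \<omega> lam)"
  have carr: "carrier (U_iso \<omega> lam) = {h. \<forall>m. coeff h m \<in> Lalg lam}"
    and mul: "mult (U_iso \<omega> lam) = ?m"
    by (simp_all add: U_iso_def ore_ring_def)
  have "k \<in> {h. \<forall>m. coeff h m \<in> Lalg lam}" using assms by (simp add: carr)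
  then show ?thesis unfolding mul
  proof (induction k)
    case 0
    show ?case
      by (rule exI[of _ 0])
         (simp add: ore_data.mult_0_right[OF ore_data_U] pairing_ev ev_zero_right)
  next
    case (pCons u k)
    have k: "k \<in> {h. \<forall>m. coeff h m \<in> Lalg lam}" and u: "u \<in> Lalg lam"
      using pCons.prems by (simp_all only: ore_data.pCons_C[OF ore_data_U])
    obtain G where G: "degree G \<le> degree F"
      "\<And>h. h \<in> carrier (U_iso \<omega> lam) \<Longrightarrow> pairing h G = pairing (?m h k) F"
      using pCons.IH[OF k] by blast
    obtain G1 where G1: "degree G1 \<le> degree G"
      "\<And>h. h \<in> carrier (U_iso \<omega> lam) \<Longrightarrow> pairing h G1 = pairing (?R h) G"
      using exists_J by blast
    obtain G2 where G2: "degree G2 \<le> degree F"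
      "\<And>h. h \<in> carrier (U_iso \<omega> lam) \<Longrightarrow> pairing h G2 = pairing (smult u h) F"
      using exists_smult[OF u] by blast
    have "degree (G2 + G1) \<le> degree F"
      using G(1) G1(1) G2(1) by (intro degree_add_le) auto
    moreover have "pairing h (G2 + G1) = pairing (?m h (pCons u k)) F"
      if h: "h \<in> carrier (U_iso \<omega> lam)" for h
    proof -
      have Rh: "?R h \<in> carrier (U_iso \<omega> lam)"
        using ore_data.R_C[OF ore_data_U] h unfolding carr by blast
      have s: "smult u h \<in> carrier (U_iso \<omega> lam)"
        using ore_data.smult_C[OF ore_data_U u] h unfolding carr by blast
      have m: "?m (?R h) k \<in> carrier (U_iso \<omega> lam)"
        using ore_data.mult_C[OF ore_data_U] Rh k unfolding carr by blast
      show ?thesis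
        by (simp only: pairing_add_right G2(2)[OF h] G1(2)[OF h] G(2)[OF Rh]
            ore_data.mult_pCons[OF ore_data_U] pairing_add_left[OF s m])
    qed
    ultimately show ?case by blast
  qed
qed

definition mono_fun :: "complex \<Rightarrow> nat \<Rightarrow> nat \<Rightarrow> plane_fun" where
  "mono_fun c n p = (\<lambda>(x, y). c * of_real x ^ n * of_real y ^ p)"

lemma mono_fun_Lalg: "mono_fun c n p \<in> Lalg lam"
proof -
  let ?x = "\<lambda>(x::real, y::real). complex_of_real x" and ?y = "\<lambda>(x::real, y::real). complex_of_real y"
  have pw: "(\<lambda>q. l q ^ n) \<in> Lalg lam" if "l \<in> Lalg lam" for l n
    by (induction n) (use Lalg_const[of 1] Lalg_mult[OF that] in \<open>simp_all add: times_fun_def\<close>)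
  have "mono_fun c n p = (\<lambda>_. c) * (\<lambda>q. ?x q ^ n) * (\<lambda>q. ?y q ^ p)"
    by (simp add: mono_fun_def times_fun_def case_prod_unfold)
  moreover have "\<dots> \<in> Lalg lam"
    by (intro Lalg_mult Lalg_const pw Lalg_P1 Lalg_P2)
  ultimately show ?thesis by simp
qed

lemma pd_mono_fun:
  "pd1 (mono_fun c n p) = mono_fun (c * of_nat n) (n - 1) p"
  "pd2 (mono_fun c n p) = mono_fun (c * of_nat p) n (p - 1)"
proof -
  have "has_pd (mono_fun c n p) (mono_fun (c * of_nat n) (n - 1) p) (mono_fun (c * of_nat p) n (p - 1))"
    unfolding has_pd_def mono_fun_def
    by (auto intro!: derivative_eq_intros has_vector_derivative_of_real
        simp: algebra_simps simp flip: of_real_power has_real_derivative_iff_has_vector_derivative)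
  from has_pd_pd[OF this] show
    "pd1 (mono_fun c n p) = mono_fun (c * of_nat n) (n - 1) p"
    "pd2 (mono_fun c n p) = mono_fun (c * of_nat p) n (p - 1)" .
qed

lemma pdD_mono_fun:
  "pdD r s (mono_fun c n p) = (if r = n \<and> s = p then c * fact n * fact p else 0)"
proof (induction s arbitrary: c p)
  case 0
  show ?case
  proof (induction r arbitrary: c n)
    case 0
    show ?case by (simp add: pdD_def mono_fun_def)
  next
    case (Suc r)
    have "pdD (Suc r) 0 (mono_fun c n p) = pdD r 0 (mono_fun (c * of_nat n) (n - 1) p)"
      by (simp only: pdD_pd(1)[OF mono_fun_Lalg[of _ _ _ 0], symmetric] pd_mono_fun)
    then show ?case by (cases n) (auto simp: Suc)
  qed
next
  case (Suc s)
  have "pdD r (Suc s) (mono_fun c n p) = pdD r s (mono_fun (c * of_nat p) n (p - 1))"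
    by (simp only: pdD_pd(2)[symmetric] pd_mono_fun)
  then show ?case by (cases p) (auto simp: Suc)
qed

text \<open>\<open>\<langle>J^m P\<^sub>1^n P\<^sub>2^p, \<Sum> c\<^sub>q\<^sub>r\<^sub>s \<phi>^q a\<^sub>1^r a\<^sub>2^s\<rangle> = m! n! p! c\<^sub>m\<^sub>n\<^sub>p\<close>.\<close>

theorem pairing_monom:
  "pairing (monom (mono_fun 1 n p) m) F = fact m * fact n * fact p * coeff (coeff (coeff F m) n) p"
proof -
  have e: "ev f (mono_fun 1 n p) = fact n * fact p * coeff (coeff f n) p" for f
  proof -
    obtain M where M: "\<And>r. degree (coeff f r) \<le> M" using degree_bound by metis
    let ?N = "max (degree f) n" and ?M = "max M p"
    have "ev f (mono_fun 1 n p) = (\<Sum>r\<le>?N. \<Sum>s\<le>?M. coeff (coeff f r) s * pdD r s (mono_fun 1 n p))"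
      by (rule ev_bound) (use M in \<open>auto simp: le_max_iff_disj\<close>)
    also have "\<dots> = (\<Sum>r\<le>?N. if r = n then coeff (coeff f n) p * (fact n * fact p) else 0)"
    proof (rule sum.cong[OF refl])
      fix r
      have "(\<Sum>s\<le>?M. coeff (coeff f r) s * pdD r s (mono_fun 1 n p)) =
        (\<Sum>s\<le>?M. if s = p then (if r = n then coeff (coeff f n) p * (fact n * fact p) else 0) else 0)"
        by (intro sum.cong refl) (auto simp: pdD_mono_fun)
      then show "(\<Sum>s\<le>?M. coeff (coeff f r) s * pdD r s (mono_fun 1 n p)) =
          (if r = n then coeff (coeff f n) p * (fact n * fact p) else 0)"
        by simp
    qed
    also have "\<dots> = fact n * fact p * coeff (coeff f n) p" by simp
    finally show ?thesis .
  qed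
  let ?N = "max (degree F) m"
  have "pairing (monom (mono_fun 1 n p) m) F =
      (\<Sum>q\<le>?N. if q = m then fact m * (fact n * fact p * coeff (coeff (coeff F m) n) p) else 0)"
    unfolding pairing_bound[of F ?N, OF max.cobounded1]
    by (rule sum.cong) (auto simp: e ev_zero_right)
  then show ?thesis by simp
qed

lemma pairing_nondegenerate:
  assumes "\<And>h. h \<in> carrier (U_iso \<omega> lam) \<Longrightarrow> pairing h F = pairing h G"
  shows "F = G"
proof (intro poly_eqI)
  fix m n p
  have "monom (mono_fun 1 n p) m \<in> carrier (U_iso \<omega> lam)"
    by (simp add: U_iso_def ore_ring_def mono_fun_Lalg)
  from assms[OF this] show "coeff (coeff (coeff F m) n) p = coeff (coeff (coeff G m) n) p"
    by (simp add: pairing_monom)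
qed

theorem left_act_pairing:
  assumes "h \<in> carrier (U_iso \<omega> lam)" "h' \<in> carrier (U_iso \<omega> lam)"
  shows "pairing h' (left_act \<omega> lam h F) = pairing (h' \<otimes>\<^bsub>U_iso \<omega> lam\<^esub> h) F"
proof -
  have "\<exists>!G. \<forall>h' \<in> carrier (U_iso \<omega> lam). pairing h' G = pairing (h' \<otimes>\<^bsub>U_iso \<omega> lam\<^esub> h) F"
    using left_act_exists[OF assms(1)] pairing_nondegenerate[of \<omega> lam]
    by (intro ex_ex1I) (blast, metis)
  from theI'[OF this] assms(2) show ?thesis by (simp add: left_act_def)
qed

theorem left_act_stable:
  assumes "h \<in> carrier (U_iso \<omega> lam)"
  shows "\<exists>g. left_act \<omega> lam h [:f:] = [:g:]"
proof -
  obtain G where G: "degree G \<le> degree [:f:]"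
    "\<forall>k \<in> carrier (U_iso \<omega> lam). pairing k G = pairing (k \<otimes>\<^bsub>U_iso \<omega> lam\<^esub> h) [:f:]"
    using left_act_exists[OF assms] by blast
  then have "left_act \<omega> lam h [:f:] = G"
    using left_act_pairing[OF assms] by (intro pairing_nondegenerate[of \<omega> lam]) simp
  then show ?thesis using G(1) degree_eq_zeroE[of G] by auto
qed


section \<open>Operators on ordered polynomials\<close>

definition da1 :: "A_elem \<Rightarrow> A_elem" where "da1 = pderiv"

definition da2 :: "A_elem \<Rightarrow> A_elem" where "da2 = map_poly pderiv"

definition shift_a2 :: "real \<Rightarrow> A_elem \<Rightarrow> A_elem" where
  "shift_a2 c = map_poly (\<lambda>p. p \<circ>\<^sub>p [:complex_of_real c, 1:])"

lemma A_iso_const_pow: "[:p:] [^]\<^bsub>A_iso lam\<^esub> (s::nat) = [:p ^ s:]"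
proof (induction s)
  case 0 show ?case by (simp add: A_iso_def ore_ring_def nat_pow_def one_pCons)
next
  case (Suc s)
  then show ?case
    by (simp add: A_iso_def ore_ring_def nat_pow_def ore_data.mult_const[OF ore_data_A] mult.commute)
qed

theorem A_iso_monom:
  "a1 [^]\<^bsub>A_iso lam\<^esub> (r::nat) \<otimes>\<^bsub>A_iso lam\<^esub> a2 [^]\<^bsub>A_iso lam\<^esub> (s::nat) = monom (monom 1 s) r"
proof -
  have "[:0, 1:] ^ s = (monom 1 s :: complex poly)" by (simp add: monom_altdef)
  then show ?thesis
    using ore_data.ore_monom[OF ore_data_A, of lam r "monom 1 s"]
    unfolding A_iso_const_pow by (simp add: A_iso_def ore_ring_def)
qed

theorem shift_a2_monom:
  "shift_a2 c (a1 [^]\<^bsub>A_iso lam\<^esub> (r::nat) \<otimes>\<^bsub>A_iso lam\<^esub> a2 [^]\<^bsub>A_iso lam\<^esub> (s::nat)) =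
   a1 [^]\<^bsub>A_iso lam\<^esub> r \<otimes>\<^bsub>A_iso lam\<^esub> [:[:complex_of_real c, 1:]:] [^]\<^bsub>A_iso lam\<^esub> s"
proof -
  have "[:0, 1:] ^ s \<circ>\<^sub>p q = q ^ s" for q :: "complex poly"
    by (induction s) (simp_all add: pcompose_mult pcompose_pCons pcompose_1)
  moreover have "a1 [^]\<^bsub>A_iso lam\<^esub> r \<otimes>\<^bsub>A_iso lam\<^esub> [:p:] = monom p r" for p
    using ore_data.ore_monom[OF ore_data_A, of lam r p] by (simp add: A_iso_def ore_ring_def)
  ultimately show ?thesis
    by (simp add: A_iso_monom A_iso_const_pow shift_a2_def map_poly_monom)
qed

text \<open>The power series \<open>Q(D)\<close>.  Only used for operators \<open>D\<close> such that \<open>(D ^^ n) f\<close> vanishes for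
  all but finitely many \<open>n\<close>, which is the case for \<open>da2\<close>.\<close>

definition fps_op :: "complex fps \<Rightarrow> (A_elem \<Rightarrow> A_elem) \<Rightarrow> A_elem \<Rightarrow> A_elem" where
  "fps_op Q D f = (\<Sum>n | (D ^^ n) f \<noteq> 0. smult [:fps_nth Q n:] ((D ^^ n) f))"

lemma finite_da2_support: "finite {n. (da2 ^^ n) f \<noteq> 0}"
proof -
  have c: "coeff ((da2 ^^ n) f) r = (pderiv ^^ n) (coeff f r)" for n r
    by (induction n) (simp_all add: da2_def coeff_map_poly)
  have z: "(pderiv ^^ n) p = 0" if "degree p < n" for n and p :: "complex poly"
    using that
  proof (induction n arbitrary: p)
    case (Suc n)
    show ?case
    proof (cases "degree p = 0")
      case True
      then have "pderiv p = 0" by (simp add: pderiv_eq_0_iff)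
      moreover have "(pderiv ^^ n) (0 :: complex poly) = 0" for n by (induction n) auto
      ultimately show ?thesis by (simp add: funpow_swap1 funpow_Suc_right del: funpow.simps)
    next
      case False
      then have "degree (pderiv p) < n" using Suc.prems by (simp add: degree_pderiv)
      then show ?thesis using Suc.IH by (simp add: funpow_Suc_right del: funpow.simps)
    qed
  qed simp
  define N where "N = (\<Sum>r\<le>degree f. degree (coeff f r))"
  have "degree (coeff f r) \<le> N" for r
    by (cases "r \<le> degree f")
       (auto simp: N_def coeff_eq_0 intro: member_le_sum)
  then have "(da2 ^^ n) f = 0" if "N < n" for n
    by (intro poly_eqI) (simp add: c z le_less_trans[OF _ that])
  then have "{n. (da2 ^^ n) f \<noteq> 0} \<subseteq> {..N}" by (auto simp: not_less[symmetric])
  then show ?thesis by (rule finite_subset) simp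
qed

definition fps_sinh :: "complex \<Rightarrow> complex fps" where
  "fps_sinh c = fps_const (1 / 2) * (fps_exp c - fps_exp (- c))"

text \<open>\<open>\<omega> P\<^sub>1\<^sup>2 e^(\<lambda> P\<^sub>2) + (4/\<lambda>\<^sup>2) sinh\<^sup>2(\<lambda> P\<^sub>2 / 2)\<close>, first as a function on the plane and then
  as an element of the algebra.\<close>

definition casimir_fun :: "real \<Rightarrow> real \<Rightarrow> plane_fun" where
  "casimir_fun \<omega> lam = (\<lambda>(x, y).
     complex_of_real (\<omega> * x\<^sup>2 * exp (lam * y) + 4 / lam\<^sup>2 * (sinh (lam / 2 * y))\<^sup>2))"

definition casimir :: "real \<Rightarrow> real \<Rightarrow> plane_fun poly" where
  "casimir \<omega> lam = [:casimir_fun \<omega> lam:]"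

end

(*
The Casimir function c satisfies Jhat c = 0, so it commutes with J as well as with the
commutative subalgebra.  For the action, <h', c > f> = <c h', f> only involves the J-free part l of
h', so one needs the transposes, with respect to (f, l) |-> (f(d_1, d_2) l)(0, 0), of
multiplication by P_1 and by e^{t P_2}: these are d/da_1 and the shift of a_2 by t.
*)
theory Submission
  imports Defs
begin

section \<open>Transposes of multiplication operators\<close>

text \<open>A factor \<open>a1\<close> pairs as one application of \<open>pd1\<close>. Peeling it
  off replaces the double sum in \<open>ev\<close> by a recursion along the coefficients of
  \<open>f\<close>, so that later identities follow by induction on \<open>f\<close> with
  \<open>l\<close> arbitrary.\<close>

lemma ev_pCons:
  assumes "l \<in> Lalg lam"
  shows "ev (pCons p f) l = ev [:p:] l + ev f (pd1 l)"
proof -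
  obtain M where M: "\<And>r. degree (coeff (pCons p f) r) \<le> M" using degree_bound by metis
  have p: "degree p \<le> M" using M[of 0] by simp
  have f: "degree (coeff f r) \<le> M" for r using M[of "Suc r"] by simp
  have p': "degree (coeff [:p:] r) \<le> M" for r using p by (simp add: coeff_pCons split: nat.splits)
  have "ev (pCons p f) l =
      (\<Sum>r\<le>Suc (degree f). \<Sum>s\<le>M. coeff (coeff (pCons p f) r) s * pdD r s l)"
    by (rule ev_bound[OF _ M]) (rule degree_pCons_le)
  also have "\<dots> = (\<Sum>s\<le>M. coeff p s * pdD 0 s l)
      + (\<Sum>r\<le>degree f. \<Sum>s\<le>M. coeff (coeff f r) s * pdD r s (pd1 l))"
    by (simp add: sum.atMost_Suc_shift pdD_pd(1)[OF assms] del: sum.atMost_Suc)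
  also have "(\<Sum>s\<le>M. coeff p s * pdD 0 s l) = ev [:p:] l"
    by (subst ev_bound[of _ 0 M]) (simp_all add: p')
  also have "(\<Sum>r\<le>degree f. \<Sum>s\<le>M. coeff (coeff f r) s * pdD r s (pd1 l)) = ev f (pd1 l)"
    by (rule ev_bound[OF order_refl f, symmetric])
  finally show ?thesis .
qed

text \<open>The companion recursion for \<open>a2\<close>, which pairs as \<open>pd2\<close>. In
  \<open>pdD\<close> the \<open>pd2\<close> are applied first, so an extra one is absorbed directly,
  whereas an extra \<open>pd1\<close> has to be commuted past them.\<close>

lemma ev_const_pCons: "ev [:pCons a p:] l = a * l (0, 0) + ev [:p:] (pd2 l)"
proof -
  have d: "degree (coeff [:q:] r) \<le> M" if "degree q \<le> M" for q :: "complex poly" and r M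
    using that by (simp add: coeff_pCons split: nat.splits)
  have "ev [:pCons a p:] l =
      (\<Sum>r\<le>0. \<Sum>s\<le>Suc (degree p). coeff (coeff [:pCons a p:] r) s * pdD r s l)"
    by (rule ev_bound) (simp, rule d, rule degree_pCons_le)
  also have "\<dots> = a * l (0, 0) + (\<Sum>s\<le>degree p. coeff p s * pdD 0 s (pd2 l))"
    by (simp add: sum.atMost_Suc_shift pdD_pd(2) del: sum.atMost_Suc) (simp add: pdD_def)
  also have "(\<Sum>s\<le>degree p. coeff p s * pdD 0 s (pd2 l)) = ev [:p:] (pd2 l)"
    by (subst ev_bound[of _ 0 "degree p"]) (simp_all add: d)
  finally show ?thesis .
qed

lemma pd_const: "pd1 (\<lambda>_. c) = 0" "pd2 (\<lambda>_. c) = 0"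
  using has_pd_pd[OF has_pd_const] by auto

lemma ev_scale_right:
  assumes "l \<in> Lalg lam"
  shows "ev f ((\<lambda>_. c) * l) = c * ev f l"
proof -
  have ev0: "ev [:p:] ((\<lambda>_. c) * l) = c * ev [:p:] l" if "l \<in> Lalg lam" for p l
    using that
  proof (induction p arbitrary: l)
    case (pCons a p)
    have "pd2 ((\<lambda>_. c) * l) = (\<lambda>_. c) * pd2 l"
      by (simp only: pd_mult(2)[OF Lalg_const pCons.prems] pd_const mult_zero_left add_0_left)
    then show ?case
      by (simp only: ev_const_pCons pCons.IH[OF Lalg_pd(2)[OF pCons.prems]])
        (simp add: algebra_simps)
  qed simp
  show ?thesis using assms
  proof (induction f arbitrary: l)
    case (pCons p f)
    note L = pCons.prems
    have "pd1 ((\<lambda>_. c) * l) = (\<lambda>_. c) * pd1 l"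
      by (simp only: pd_mult(1)[OF Lalg_const L] pd_const mult_zero_left add_0_left)
    then show ?case
      by (simp only: ev_pCons[OF L, of p f] ev_pCons[OF Lalg_mult[OF Lalg_const L], of p f] ev0[OF L]
          pCons.IH[OF Lalg_pd(1)[OF L]] distrib_left)
  qed simp
qed

section \<open>Transposes of \<open>P1\<close> and of exponentials in \<open>P2\<close>\<close>

abbreviation P1 :: plane_fun where "P1 \<equiv> \<lambda>(x, y). complex_of_real x"

abbreviation exp_P2 :: "real \<Rightarrow> plane_fun" where
  "exp_P2 c \<equiv> \<lambda>(x, y). complex_of_real (exp (c * y))"

text \<open>By Leibniz, the r-th derivative of \<open>P1 * l\<close> in the first variable, taken at
  the origin, is r times the (r-1)-th derivative of \<open>l\<close>. In the induction,
  \<open>pd1 (P1 * l) = l + P1 * pd1 l\<close> mirrors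
  \<open>pderiv (pCons p f) = f + pCons 0 (pderiv f)\<close>.\<close>

lemma ev_mult_P1:
  assumes "l \<in> Lalg lam"
  shows "ev f (P1 * l) = ev (da1 f) l"
proof -
  note pdP = has_pd_pd[OF has_pd_P1]
  \<comment> \<open>A polynomial in \<open>a2\<close> alone only applies \<open>pd2\<close>, which
    passes through \<open>P1\<close>, and \<open>P1\<close> vanishes at the origin.\<close>
  have ev0: "ev [:p:] (P1 * l) = 0" if "l \<in> Lalg lam" for p l
    using that
  proof (induction p arbitrary: l)
    case (pCons a p)
    have "pd2 (P1 * l) = P1 * pd2 l"
      by (simp only: pd_mult(2)[OF Lalg_P1 pCons.prems] pdP mult_zero_left add_0_left)
    then show ?case
      by (simp only: ev_const_pCons pCons.IH[OF Lalg_pd(2)[OF pCons.prems]]) simp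
  qed simp
  show ?thesis using assms
  proof (induction f arbitrary: l)
    case (pCons p f)
    note L = pCons.prems Lalg_pd(1)[OF pCons.prems]
    have "ev (pCons p f) (P1 * l) = ev f l + ev f (P1 * pd1 l)"
      by (simp only: ev_pCons[OF Lalg_mult[OF Lalg_P1 L(1)], of p f] ev0[OF L(1)]
          pd_mult(1)[OF Lalg_P1 L(1)] pdP mult_1_left add_0_left
          ev_add_right[OF L(1) Lalg_mult[OF Lalg_P1 L(2)]])
    also have "\<dots> = ev (da1 (pCons p f)) l"
      unfolding da1_def pderiv_pCons ev_add ev_pCons[OF L(1), of 0 "pderiv f"]
      by (simp add: pCons.IH[OF L(2)] da1_def)
    finally show ?case .
  qed (simp add: da1_def)
qed

text \<open>Since \<open>pd2 (exp_P2 c * l) = exp_P2 c * (c * l + pd2 l)\<close> and the exponential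
  is 1 at the origin, moving it out turns each \<open>pd2\<close> into \<open>pd2 + c\<close>, that
  is, \<open>a2\<close> into \<open>a2 + c\<close>.\<close>

lemma ev_mult_exp_P2:
  assumes e: "exp_P2 c \<in> Lalg lam" and "l \<in> Lalg lam"
  shows "ev f (exp_P2 c * l) = ev (shift_a2 c f) l"
proof -
  let ?T = "\<lambda>p. p \<circ>\<^sub>p [:complex_of_real c, 1:]"
  have pd2e: "pd2 (exp_P2 c) = (\<lambda>_. of_real c) * exp_P2 c" and pd1e: "pd1 (exp_P2 c) = 0"
    by (auto simp: has_pd_pd[OF has_pd_exp] fun_eq_iff)
  have ev0: "ev [:p:] (exp_P2 c * l) = ev [:?T p:] l" if "l \<in> Lalg lam" for p l
    using that
  proof (induction p arbitrary: l)
    case 0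
    then show ?case by simp
  next
    case (pCons a p)
    let ?c = "(\<lambda>_. of_real c) :: plane_fun"
    note L = pCons.prems
    note L' = Lalg_mult[OF Lalg_const L, of "of_real c"]
    have pd: "pd2 (exp_P2 c * l) = exp_P2 c * (?c * l + pd2 l)"
      unfolding pd_mult(2)[OF e L] pd2e by (simp only: distrib_left distrib_right mult_ac add_ac)
    have "ev [:pCons a p:] (exp_P2 c * l) = a * l (0, 0) + ev [:?T p:] (?c * l + pd2 l)"
      unfolding ev_const_pCons pd pCons.IH[OF Lalg_add[OF L' Lalg_pd(2)[OF L]]] by simp
    also have "\<dots> = a * l (0, 0) + of_real c * ev [:?T p:] l + ev [:?T p:] (pd2 l)"
      by (simp add: ev_add_right[OF L' Lalg_pd(2)[OF L]] ev_scale_right[OF L])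
    \<comment> \<open>The Horner step of the substitution: \<open>a + X p\<close> becomes
      \<open>a + (c + X) ?T p\<close>.\<close>
    also have "\<dots> = ev (smult [:of_real c:] [:?T p:] + [:pCons a (?T p):]) l"
      unfolding ev_add ev_smult ev_const_pCons by simp
    also have "smult [:of_real c:] [:?T p:] + [:pCons a (?T p):] = [:?T (pCons a p):]"
      by (simp add: pcompose_pCons)
    finally show ?case .
  qed
  show ?thesis using assms(2)
  proof (induction f arbitrary: l)
    case (pCons p f)
    note L = pCons.prems
    have "shift_a2 c (pCons p f) = pCons (?T p) (shift_a2 c f)"
      by (simp add: shift_a2_def map_poly_pCons)
    moreover have "pd1 (exp_P2 c * l) = exp_P2 c * pd1 l"
      by (simp only: pd_mult(1)[OF e L] pd1e mult_zero_left add_0_left)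
    ultimately show ?case
      by (simp only: ev_pCons[OF Lalg_mult[OF e L], of p f] ev_pCons[OF L, of "?T p" "shift_a2 c f"]
          ev0[OF L] pCons.IH[OF Lalg_pd(1)[OF L]])
  qed (simp add: shift_a2_def)
qed


section \<open>Taylor's formula and power series of operators\<close>

lemma smult_sum_right: "smult c (sum f A) = (\<Sum>x\<in>A. smult c (f x))"
  by (induction A rule: infinite_finite_induct) (simp_all add: smult_add_right)

text \<open>The Leibniz rule for \<open>a + X p\<close>: at most one of the derivatives can hit the
  factor \<open>X\<close>.\<close>

lemma pderiv_funpow_pCons:
  fixes p :: "'a::{comm_semiring_1,semiring_no_zero_divisors} poly"
  shows "(pderiv ^^ Suc n) (pCons a p) =
    smult (of_nat (Suc n)) ((pderiv ^^ n) p) + pCons 0 ((pderiv ^^ Suc n) p)"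
proof (induction n)
  case (Suc n)
  have "(pderiv ^^ Suc (Suc n)) (pCons a p) = pderiv ((pderiv ^^ Suc n) (pCons a p))" by simp
  also have "\<dots> = smult (of_nat (Suc (Suc n))) ((pderiv ^^ Suc n) p)
      + pCons 0 ((pderiv ^^ Suc (Suc n)) p)"
    unfolding Suc
    by (simp add: pderiv_add pderiv_smult pderiv_pCons smult_add_left add_ac)
  finally show ?case .
qed (simp add: pderiv_pCons)

text \<open>Allowing any bound \<open>N\<close> on the degree, rather than the degree itself, lets
  the induction hypothesis be used at two different cutoffs.\<close>

lemma pcompose_offset_taylor:
  fixes p :: "'a::field_char_0 poly"
  assumes "degree p \<le> N"
  shows "p \<circ>\<^sub>p [:c, 1:] = (\<Sum>n\<le>N. smult (c ^ n / fact n) ((pderiv ^^ n) p))"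
  using assms
proof (induction p arbitrary: N)
  case 0
  then show ?case by simp
next
  case (pCons a p)
  show ?case
  proof (cases "p = 0")
    \<comment> \<open>Constants are separate because \<open>degree (pCons a p)\<close> exceeds
      \<open>degree p\<close> by one only for nonzero \<open>p\<close>; here \<open>N\<close> may be
      0.\<close>
    case True
    have "smult (c ^ n / fact n) ((pderiv ^^ n) [:a:]) = (if n = 0 then [:a:] else 0)" for n
      by (cases n) (simp_all add: funpow_Suc_right pderiv_pCons del: funpow.simps)
    then show ?thesis using True by simp
  next
    case False
    then obtain M where N: "N = Suc M" and M: "degree p \<le> M"
      using pCons.prems by (cases N) auto
    let ?d = "\<lambda>n. (pderiv ^^ n) p"
    have "(\<Sum>n\<le>N. smult (c ^ n / fact n) ((pderiv ^^ n) (pCons a p))) =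
        pCons a p + (\<Sum>n\<le>M. smult (c ^ Suc n / fact (Suc n)) ((pderiv ^^ Suc n) (pCons a p)))"
      unfolding N by (subst sum.atMost_Suc_shift) simp
    also have "(\<Sum>n\<le>M. smult (c ^ Suc n / fact (Suc n)) ((pderiv ^^ Suc n) (pCons a p))) =
        (\<Sum>n\<le>M. smult c (smult (c ^ n / fact n) (?d n))
          + [:0, 1:] * smult (c ^ Suc n / fact (Suc n)) (?d (Suc n)))"
    proof (rule sum.cong[OF refl])
      fix n
      \<comment> \<open>The Leibniz factor n+1 cancels against (n+1)!, leaving c times the previous
        Taylor coefficient.\<close>
      have "c ^ Suc n / fact (Suc n) * of_nat (Suc n) = c * (c ^ n / fact n)"
        by (simp add: fact_Suc field_simps del: of_nat_Suc)
      then show "smult (c ^ Suc n / fact (Suc n)) ((pderiv ^^ Suc n) (pCons a p)) =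
          smult c (smult (c ^ n / fact n) (?d n))
            + [:0, 1:] * smult (c ^ Suc n / fact (Suc n)) (?d (Suc n))"
        unfolding pderiv_funpow_pCons
        by (simp add: smult_add_right del: funpow.simps of_nat_Suc fact_Suc power_Suc)
    qed
    also have "\<dots> = smult c (\<Sum>n\<le>M. smult (c ^ n / fact n) (?d n))
        + [:0, 1:] * (\<Sum>n\<le>M. smult (c ^ Suc n / fact (Suc n)) (?d (Suc n)))"
      by (simp only: sum.distrib sum_distrib_left smult_sum_right)
    \<comment> \<open>The part \<open>X p\<close> of \<open>pCons a p\<close> is the missing term n
      = 0 of the second sum, which then runs up to \<open>Suc M\<close>.\<close>
    also have "pCons a p + \<dots> = [:a:] + (smult c (\<Sum>n\<le>M. smult (c ^ n / fact n) (?d n))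
        + [:0, 1:] * (\<Sum>n\<le>Suc M. smult (c ^ n / fact n) (?d n)))"
      unfolding sum.atMost_Suc_shift[of _ M] by (simp add: algebra_simps del: sum.atMost_Suc)
    also have "\<dots> = pCons a p \<circ>\<^sub>p [:c, 1:]"
      unfolding pCons.IH[OF M, symmetric] pCons.IH[OF le_SucI[OF M], symmetric]
      by (simp add: pcompose_pCons)
    finally show ?thesis by simp
  qed
qed

section \<open>Power series in \<open>da2\<close>\<close>

lemma fps_op_bound:
  assumes "finite A" "{n. (D ^^ n) f \<noteq> 0} \<subseteq> A"
  shows "fps_op Q D f = (\<Sum>n\<in>A. smult [:fps_nth Q n:] ((D ^^ n) f))"
  unfolding fps_op_def using assms by (intro sum.mono_neutral_left) auto

text \<open>The index set of the sum depends on \<open>D\<close> and \<open>f\<close> but not on the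
  series, so the terms add up one by one.\<close>

lemma fps_op_add: "fps_op (Q + Q') D f = fps_op Q D f + fps_op Q' D f"
proof -
  have "smult [:x + y:] g = smult [:x:] g + smult [:y:] g" for x y and g :: A_elem
    using smult_add_left[of "[:x:]" "[:y:]" g] by simp
  then show ?thesis by (simp add: fps_op_def sum.distrib)
qed

lemma fps_op_const_mult: "fps_op (fps_const c * Q) D f = smult [:c:] (fps_op Q D f)"
  by (simp add: fps_op_def smult_sum_right mult.commute)

lemma fps_op_1_da2: "fps_op 1 da2 f = f"
proof -
  have "fps_op 1 da2 f =
      (\<Sum>n\<in>insert 0 {n. (da2 ^^ n) f \<noteq> 0}. smult [:fps_nth 1 n:] ((da2 ^^ n) f))"
    by (rule fps_op_bound) (use finite_da2_support in auto)
  also have "\<dots> = (\<Sum>n\<in>{0}. smult [:fps_nth 1 n:] ((da2 ^^ n) f))"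
    by (rule sum.mono_neutral_right) (use finite_da2_support in auto)
  finally show ?thesis by (simp add: one_pCons[symmetric])
qed

text \<open>Taylor's formula, applied to each coefficient of a power of \<open>a1\<close>.\<close>

lemma fps_op_exp_da2: "fps_op (fps_exp (complex_of_real c)) da2 f = shift_a2 c f"
proof -
  obtain M where M: "\<And>r. degree (coeff f r) \<le> M" using degree_bound by metis
  obtain N0 where N0: "{n. (da2 ^^ n) f \<noteq> 0} \<subseteq> {..N0}"
    using finite_da2_support[of f] finite_nat_set_iff_bounded_le by auto
  \<comment> \<open>One cutoff for both purposes: \<open>M\<close> bounds the degrees in
    \<open>a2\<close>, as Taylor's formula requires, and \<open>N0\<close> bounds the support of the
    operator sum.\<close>
  let ?N = "max M N0"
  have c: "coeff ((da2 ^^ n) f) r = (pderiv ^^ n) (coeff f r)" for n r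
    by (induction n) (simp_all add: da2_def coeff_map_poly)
  have "fps_op (fps_exp (complex_of_real c)) da2 f =
      (\<Sum>n\<le>?N. smult [:complex_of_real c ^ n / fact n:] ((da2 ^^ n) f))"
    by (subst fps_op_bound[of "{..?N}"]) (use N0 in auto)
  also have "\<dots> = shift_a2 c f"
  proof (rule poly_eqI)
    fix r
    have "degree (coeff f r) \<le> ?N" using M[of r] by simp
    from pcompose_offset_taylor[OF this, of "complex_of_real c"]
    show "coeff (\<Sum>n\<le>?N. smult [:complex_of_real c ^ n / fact n:] ((da2 ^^ n) f)) r =
        coeff (shift_a2 c f) r"
      by (simp add: coeff_sum c shift_a2_def coeff_map_poly)
  qed
  finally show ?thesis .
qed

lemma fps_sinh_half_square:
  "4 * (fps_sinh (c / 2))\<^sup>2 = fps_exp c + fps_exp (- c) - 2"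
proof -
  have "fps_exp (c / 2) * fps_exp (c / 2) = fps_exp c"
    "fps_exp (- (c / 2)) * fps_exp (- (c / 2)) = fps_exp (- c)"
    "fps_exp (c / 2) * fps_exp (- (c / 2)) = 1"
    by (simp_all flip: fps_exp_add_mult)
  moreover have "4 * (fps_const (1 / 2))\<^sup>2 = (1 :: complex fps)"
    by (simp add: power2_eq_square numeral_fps_const)
  then have "4 * (fps_sinh (c / 2))\<^sup>2 = (fps_exp (c / 2) - fps_exp (- (c / 2)))\<^sup>2"
    by (simp only: fps_sinh_def power_mult_distrib mult_1_left flip: mult.assoc)
  moreover have "(a - b)\<^sup>2 = a * a + b * b - 2 * (a * b)" for a b :: "complex fps"
    by (simp add: power2_eq_square algebra_simps)
  ultimately show ?thesis by simp
qed


section \<open>The Casimir element\<close>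

text \<open>A normal form built from constants, \<open>P1\<close> and exponentials by sums and
  products: membership in \<open>Lalg\<close>, partial derivatives and transposes can all be read
  off factor by factor.\<close>

lemma casimir_fun_eq:
  "casimir_fun \<omega> lam = (\<lambda>_. of_real \<omega>) * (P1 * (P1 * exp_P2 lam))
    + (\<lambda>_. of_real (1 / lam\<^sup>2)) * (exp_P2 lam + exp_P2 (- lam) + (\<lambda>_. - 2))"
proof -
  have "4 * (sinh (lam / 2 * y))\<^sup>2 = exp (lam * y) + exp (- lam * y) - 2" for y
  proof -
    have "exp (lam * y) = (exp (lam * y / 2))\<^sup>2" "exp (- (lam * y)) = (exp (- (lam * y / 2)))\<^sup>2"
      "exp (lam * y / 2) * exp (- (lam * y / 2)) = 1"
      by (simp_all add: power2_eq_square mult_exp_exp flip: exp_minus)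
    then show ?thesis by (simp add: sinh_field_def power2_diff field_simps)
  qed
  then have "4 / lam\<^sup>2 * (sinh (lam / 2 * y))\<^sup>2 =
      1 / lam\<^sup>2 * (exp (lam * y) + exp (- lam * y) - 2)" for y
    by (metis times_divide_eq_left mult_1)
  then show ?thesis
    unfolding casimir_fun_def
    by (simp add: fun_eq_iff power2_eq_square del: times_divide_eq_left times_divide_eq_right)
qed

lemma exp_P2_Lalg: "exp_P2 lam \<in> Lalg lam" "exp_P2 (- lam) \<in> Lalg lam"
  using Lalg_exp[of lam] Lalg_exp_minus[of lam] by simp_all

lemma casimir_fun_Lalg: "casimir_fun \<omega> lam \<in> Lalg lam"
  unfolding casimir_fun_eq by (intro Lalg_add Lalg_mult Lalg_const Lalg_P1 exp_P2_Lalg)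

text \<open>The Casimir function is a first integral of the vector field \<open>Jhat\<close>: the
  terms in the cube of \<open>x\<close> cancel, and so do the terms linear in
  \<open>x\<close>.\<close>

lemma Jhat_casimir_fun:
  assumes "lam \<noteq> 0"
  shows "Jhat \<omega> lam (casimir_fun \<omega> lam) = 0"
proof -
  note pd = has_pd_pd[OF has_pd_add[OF
      has_pd_mult[OF has_pd_const has_pd_mult[OF has_pd_P1 has_pd_mult[OF has_pd_P1 has_pd_exp]]]
      has_pd_mult[OF has_pd_const has_pd_add[OF has_pd_add[OF has_pd_exp has_pd_exp] has_pd_const]]]]
  have 1: "pd1 (casimir_fun \<omega> lam) = (\<lambda>(x, y). of_real (2 * \<omega> * x * exp (lam * y)))"
    unfolding casimir_fun_eq pd by (simp add: fun_eq_iff algebra_simps)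
  have 2: "pd2 (casimir_fun \<omega> lam) = (\<lambda>(x, y). of_real (\<omega> * x * x * lam * exp (lam * y)
      + 1 / lam\<^sup>2 * (lam * exp (lam * y) - lam * exp (- lam * y))))"
    unfolding casimir_fun_eq pd by (simp add: fun_eq_iff algebra_simps)
  have "- ((1 - exp (- 2 * lam * y)) / (2 * lam) + 1 / 2 * lam * \<omega> * x\<^sup>2)
        * (2 * \<omega> * x * exp (lam * y))
      + \<omega> * x * (\<omega> * x * x * lam * exp (lam * y)
      + 1 / lam\<^sup>2 * (lam * exp (lam * y) - lam * exp (- lam * y))) = 0" for x y
  proof -
    have e: "exp (- 2 * lam * y) = exp (- lam * y) * exp (- lam * y)"
      "exp (- lam * y) * exp (lam * y) = 1"
      by (simp_all add: mult_exp_exp)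
    \<comment> \<open>The one relation between exponentials behind the cancellation; what remains is
      rational arithmetic.\<close>
    have "exp (- 2 * lam * y) * exp (lam * y) = exp (- lam * y)"
      using e by (simp add: mult.assoc)
    then show ?thesis using assms by (simp add: field_simps power2_eq_square)
  qed
  then show ?thesis
    unfolding Jhat_def 1 2 by (simp only: fun_eq_iff split_paired_all case_prod_conv zero_fun_def
        of_real_0 flip: of_real_mult of_real_add of_real_minus) simp
qed

text \<open>When \<open>c\<close> is fixed by \<sigma> and killed by \<delta>, right multiplication
  by the generator commutes with scaling by \<open>c\<close>. As right multiplication by
  \<open>[:c:]\<close> is scaling by \<open>c\<close> as well, this makes \<open>[:c:]\<close>
  central.\<close>

lemma (in ore_data) mult_const_left_central:
  assumes "c \<in> S" "\<sigma> c = c" "\<delta> c = 0" "k \<in> C"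
  shows "[:c:] \<odot> k = smult c k"
proof -
  \<comment> \<open>Generalised from \<open>h = 1\<close>, since the recursion on \<open>k\<close>
    replaces \<open>h\<close> by \<open>R h\<close>.\<close>
  have "smult c h \<odot> k = smult c (h \<odot> k)" if "h \<in> C" for h
    using that assms(4)
  proof (induction k arbitrary: h)
    case (pCons a k)
    have k: "k \<in> C" using pCons.prems(2) by (simp only: pCons_C)
    show ?case
      by (simp only: mult_pCons R_smult[OF assms(1) pCons.prems(1)] assms(2,3) smult_0_left
          add_0_right pCons.IH[OF R_C[OF pCons.prems(1)] k] smult_add_right smult_smult mult.commute)
  qed simp
  from this[OF one_C] show ?thesis by (simp flip: one_pCons)
qed

section \<open>The action on the co-space\<close>

lemma pairing_const: "pairing h [:f:] = ev f (coeff h 0)"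
  by (simp add: pairing_ev)

text \<open>The J-free part of \<open>h\<close> times \<open>[:c:]\<close> is
  \<open>c * coeff h 0\<close>, so the action of \<open>[:c:]\<close> on the subalgebra is the
  transpose of multiplication by \<open>c\<close>; nondegeneracy of the pairing identifies the
  result.\<close>

lemma left_act_const:
  assumes c: "c \<in> Lalg lam" and ev: "\<And>l. l \<in> Lalg lam \<Longrightarrow> ev f (c * l) = ev g l"
  shows "left_act \<omega> lam [:c:] [:f:] = [:g:]"
proof (rule pairing_nondegenerate)
  fix h assume h: "h \<in> carrier (U_iso \<omega> lam)"
  have c': "[:c:] \<in> carrier (U_iso \<omega> lam)"
    using c by (simp add: U_iso_def ore_ring_def coeff_pCons split: nat.splits)
  have "coeff h 0 \<in> Lalg lam" using h by (simp add: U_iso_def ore_ring_def)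
  then show "pairing h (left_act \<omega> lam [:c:] [:f:]) = pairing h [:g:]"
    unfolding left_act_pairing[OF c' h]
    by (simp add: U_iso_def ore_ring_def ore_data.mult_const[OF ore_data_U] pairing_const ev)
qed

lemma left_act_casimir:
  "left_act \<omega> lam (casimir \<omega> lam) [:f:] =
    [: smult [:complex_of_real \<omega>:] ((da1 ^^ 2) (shift_a2 lam f))
       + smult [:complex_of_real (1 / lam\<^sup>2):] (shift_a2 lam f + shift_a2 (- lam) f - smult 2 f) :]"
  unfolding casimir_def
proof (rule left_act_const[OF casimir_fun_Lalg])
  fix l assume l: "l \<in> Lalg lam"
  note E = Lalg_mult[OF exp_P2_Lalg(1) l] Lalg_mult[OF exp_P2_Lalg(2) l]
  note K = Lalg_mult[OF Lalg_const l, of "- 2"]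
  have PPE_Lalg: "P1 * (P1 * exp_P2 lam) * l \<in> Lalg lam"
    by (intro Lalg_mult Lalg_P1 exp_P2_Lalg l)
  note EE = Lalg_add[OF E] and EEK = Lalg_add[OF Lalg_add[OF E] K]
  have PPE: "ev f (P1 * (P1 * exp_P2 lam) * l) = ev ((da1 ^^ 2) (shift_a2 lam f)) l"
  proof -
    note Pl = Lalg_mult[OF Lalg_P1 l]
    \<comment> \<open>Transposition reverses the order: with the exponential outermost, the shift
      acts on \<open>f\<close> first and the two \<open>da1\<close> follow.\<close>
    have "P1 * (P1 * exp_P2 lam) * l = exp_P2 lam * (P1 * (P1 * l))" by (simp only: mult_ac)
    then show ?thesis
      by (simp only: ev_mult_exp_P2[OF exp_P2_Lalg(1) Lalg_mult[OF Lalg_P1 Pl]] ev_mult_P1[OF Pl]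
          ev_mult_P1[OF l]) (simp add: numeral_2_eq_2)
  qed
  have "ev f (casimir_fun \<omega> lam * l) =
      ev f ((\<lambda>_. of_real \<omega>) * (P1 * (P1 * exp_P2 lam) * l)
        + (\<lambda>_. of_real (1 / lam\<^sup>2)) * (exp_P2 lam * l + exp_P2 (- lam) * l + (\<lambda>_. - 2) * l))"
    unfolding casimir_fun_eq by (simp only: distrib_right mult.assoc)
  also have "\<dots> = of_real \<omega> * ev f (P1 * (P1 * exp_P2 lam) * l)
      + of_real (1 / lam\<^sup>2) * (ev f (exp_P2 lam * l) + ev f (exp_P2 (- lam) * l) + (- 2) * ev f l)"
    by (simp only: ev_add_right[OF Lalg_mult[OF Lalg_const PPE_Lalg] Lalg_mult[OF Lalg_const EEK]]
        ev_scale_right[OF PPE_Lalg] ev_scale_right[OF EEK] ev_add_right[OF EE K]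
        ev_add_right[OF E] ev_scale_right[OF l])
  also have "\<dots> = ev (smult [:of_real \<omega>:] ((da1 ^^ 2) (shift_a2 lam f))
      + smult [:of_real (1 / lam\<^sup>2):]
          (shift_a2 lam f + shift_a2 (- lam) f + smult [:- 2:] f)) l"
    by (simp only: PPE ev_mult_exp_P2[OF exp_P2_Lalg(1) l] ev_mult_exp_P2[OF exp_P2_Lalg(2) l]
        ev_add ev_smult)
  \<comment> \<open>In \<open>smult 2 f\<close> the numeral is a polynomial in \<open>a2\<close>,
    namely the constant \<open>[:2:]\<close>.\<close>
  also have "smult [:- 2:] f = - smult 2 f"
    by (simp add: numeral_poly flip: smult_minus_left)
  finally show "ev f (casimir_fun \<omega> lam * l) =
      ev (smult [:of_real \<omega>:] ((da1 ^^ 2) (shift_a2 lam f))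
        + smult [:of_real (1 / lam\<^sup>2):]
            (shift_a2 lam f + shift_a2 (- lam) f - smult 2 f)) l"
    by (simp only: add_uminus_conv_diff)
qed

text \<open>The squared sinh is a linear combination of two exponentials and 1, whose operators are
  two shifts and the identity.\<close>

lemma fps_op_casimir:
  "fps_op (fps_const (complex_of_real (4 / lam\<^sup>2)) * (fps_sinh (complex_of_real (lam / 2)))\<^sup>2) da2 f =
    smult [:complex_of_real (1 / lam\<^sup>2):] (shift_a2 lam f + shift_a2 (- lam) f - smult 2 f)"
proof -
  let ?e = "\<lambda>c. fps_exp (complex_of_real c)"
  have c4: "fps_const (complex_of_real (4 / lam\<^sup>2)) = fps_const (of_real (1 / lam\<^sup>2)) * 4"
    by (simp only: numeral_fps_const fps_const_mult) simp
  have sinh: "4 * (fps_sinh (complex_of_real (lam / 2)))\<^sup>2 = ?e lam + ?e (- lam) - 2"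
    using fps_sinh_half_square[of "complex_of_real lam"] by simp
  have "fps_const (complex_of_real (4 / lam\<^sup>2)) * (fps_sinh (complex_of_real (lam / 2)))\<^sup>2 =
      fps_const (of_real (1 / lam\<^sup>2)) * (?e lam + ?e (- lam) - 2)"
    unfolding c4 mult.assoc sinh ..
  \<comment> \<open>The constant -2 is written as a scalar times the series 1, to match the rules
    for \<open>fps_op\<close>.\<close>
  also have "\<dots> = fps_const (of_real (1 / lam\<^sup>2)) * (?e lam + ?e (- lam) + fps_const (- 2) * 1)"
    by (simp only: numeral_fps_const mult_1_right add_uminus_conv_diff flip: fps_const_neg)
  also have "fps_op \<dots> da2 f = smult [:of_real (1 / lam\<^sup>2):]
      (shift_a2 lam f + shift_a2 (- lam) f + smult [:- 2:] f)"
    by (simp only: fps_op_const_mult fps_op_add fps_op_exp_da2 fps_op_1_da2)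
  also have "smult [:- 2:] f = - smult 2 f"
    by (simp add: numeral_poly flip: smult_minus_left)
  finally show ?thesis by simp
qed

theorem mainTheorem4:
  fixes \<omega> lam :: real
  assumes "lam \<noteq> 0"
  shows "casimir_fun \<omega> lam = (\<lambda>(x, y).
           complex_of_real (\<omega> * x\<^sup>2 * exp (lam * y) + 2 * ((cosh (lam * y) - 1) / lam\<^sup>2)))
    \<and> casimir \<omega> lam \<in> carrier (U_iso \<omega> lam)
    \<and> (\<forall>h \<in> carrier (U_iso \<omega> lam).
         casimir \<omega> lam \<otimes>\<^bsub>U_iso \<omega> lam\<^esub> h = h \<otimes>\<^bsub>U_iso \<omega> lam\<^esub> casimir \<omega> lam)
    \<and> (\<forall>f \<in> carrier (A_iso lam).
         left_act \<omega> lam (casimir \<omega> lam) [:f:] =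
           [: smult [:complex_of_real \<omega>:]
                ((da1 ^^ 2) (fps_op (fps_exp (complex_of_real lam)) da2 f))
              + fps_op (fps_const (complex_of_real (4 / lam\<^sup>2))
                  * (fps_sinh (complex_of_real (lam / 2)))\<^sup>2) da2 f :]
       \<and> left_act \<omega> lam (casimir \<omega> lam) [:f:] =
           [: smult [:complex_of_real \<omega>:] ((da1 ^^ 2) (shift_a2 lam f))
              + smult [:complex_of_real (1 / lam\<^sup>2):]
                  (shift_a2 lam f + shift_a2 (- lam) f - smult 2 f) :])"
proof (intro conjI ballI)
  have "4 / lam\<^sup>2 * (sinh (lam / 2 * y))\<^sup>2 = 2 * ((cosh (lam * y) - 1) / lam\<^sup>2)" for y
  proof -
    \<comment> \<open>The double-angle formula at half the argument.\<close>
    have "cosh (lam * y) = 2 * (sinh (lam / 2 * y))\<^sup>2 + 1"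
      using cosh_double[of "lam / 2 * y"] cosh_square_eq[of "lam / 2 * y"] by simp
    then show ?thesis by simp
  qed
  then show "casimir_fun \<omega> lam = (\<lambda>(x, y).
      complex_of_real (\<omega> * x\<^sup>2 * exp (lam * y) + 2 * ((cosh (lam * y) - 1) / lam\<^sup>2)))"
    by (simp only: casimir_fun_def)
  show "casimir \<omega> lam \<in> carrier (U_iso \<omega> lam)"
    using casimir_fun_Lalg
    by (simp add: casimir_def U_iso_def ore_ring_def coeff_pCons split: nat.splits)
  fix h assume "h \<in> carrier (U_iso \<omega> lam)"
  then show "casimir \<omega> lam \<otimes>\<^bsub>U_iso \<omega> lam\<^esub> h = h \<otimes>\<^bsub>U_iso \<omega> lam\<^esub> casimir \<omega> lam"
    \<comment> \<open>Both products equal \<open>smult (casimir_fun \<omega> lam) h\<close>.\<close>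
    using ore_data.mult_const_left_central[OF ore_data_U casimir_fun_Lalg refl Jhat_casimir_fun[OF assms]]
    by (simp add: casimir_def U_iso_def ore_ring_def ore_data.mult_const[OF ore_data_U])
qed (simp_all only: left_act_casimir fps_op_casimir fps_op_exp_da2)

end
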